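(* Let $n\ge1$ and let $A^r(n)$ be the number of $n$-noncrossing trees modulo rotation. Then $$A^r(n)=\frac1n\left(A(n)+\mathbf 1_{n\text{ even}}\,\frac n2\,A_1\!\left(\frac n2+1\right)\right),$$ where the second term is absent when $n$ is odd.
   Context: An $n$-noncrossing tree is a tree with $n$ vertices and $n-1$ edges embedded in the closed unit disk $\overline{\mathbb D}$, with all vertices on $\partial\mathbb D$ and no two edges crossing, rooted at vertex $1$. The vertices are labelled counterclockwise $1,\dots,n$ (mod $n$), vertex $j$ being $e^{(j-1)2\pi i/n}$. Isomorphisms fix the root and preserve the cyclic order, so a tree is determined by its set of edges $\{a,b\}\subset\{1,\dots,n\}$. $A(n)$ is the number of $n$-noncrossing trees and $A_1(n)$ is the number of $n$-noncrossing trees in which vertex $1$ has degree $1$. Rotations act on these trees by translating all vertex labels by a constant modulo $n$; $A^r(n)$ is the number of orbits of this action. *)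

theory Defs
  imports "HOL-Analysis.Analysis"
begin

text \<open>A simple graph is given by its vertex set \<open>V\<close> and its set \<open>E\<close> of edges, an edge being the
  two-element set of its endpoints.\<close>

definition simple_graph :: "'a set \<Rightarrow> 'a set set \<Rightarrow> bool" where
  "simple_graph V E \<longleftrightarrow> finite V \<and> (\<forall>e\<in>E. e \<subseteq> V \<and> card e = 2)"

definition connected_graph :: "'a set \<Rightarrow> 'a set set \<Rightarrow> bool" where
  "connected_graph V E \<longleftrightarrow> V \<noteq> {} \<and> (\<forall>u\<in>V. \<forall>v\<in>V. (u, v) \<in> {(x, y). {x, y} \<in> E}\<^sup>*)"

text \<open>A cycle is listed by its pairwise distinct vertices; the last one is joined to the first.\<close>

definition is_cycle :: "'a set set \<Rightarrow> 'a list \<Rightarrow> bool" where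
  "is_cycle E vs \<longleftrightarrow> 3 \<le> length vs \<and> distinct vs \<and>
     (\<forall>i<length vs. {vs ! i, vs ! (Suc i mod length vs)} \<in> E)"

definition is_tree :: "'a set \<Rightarrow> 'a set set \<Rightarrow> bool" where
  "is_tree V E \<longleftrightarrow> simple_graph V E \<and> connected_graph V E \<and> (\<nexists>vs. is_cycle E vs)"

definition degree_in :: "'a set set \<Rightarrow> 'a \<Rightarrow> nat" where
  "degree_in E v = card {e\<in>E. v \<in> e}"

definition vertex_point :: "nat \<Rightarrow> nat \<Rightarrow> complex" where
  "vertex_point n j = cis ((real j - 1) * (2 * pi) / real n)"

text \<open>Edges are drawn as straight chords of the unit disk. Two distinct edges cross if their chords
  meet in a relatively interior point; sharing an endpoint is allowed.\<close>

definition noncrossing :: "nat \<Rightarrow> nat set set \<Rightarrow> bool" where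
  "noncrossing n E \<longleftrightarrow>
     (\<forall>a b c d. {a, b} \<in> E \<longrightarrow> {c, d} \<in> E \<longrightarrow> {a, b} \<noteq> {c, d} \<longrightarrow>
        open_segment (vertex_point n a) (vertex_point n b) \<inter>
        open_segment (vertex_point n c) (vertex_point n d) = {})"

text \<open>Isomorphisms of noncrossing trees fix the root and preserve the cyclic order of the labels,
  hence are trivial: a noncrossing tree is the same thing as its set of edges.
  The condition on the number of edges is automatic for trees.\<close>

definition noncrossing_trees :: "nat \<Rightarrow> nat set set set" where
  "noncrossing_trees n =
     {E. is_tree {1..n} E \<and> card E = n - 1 \<and> noncrossing n E}"

definition num_nct :: "nat \<Rightarrow> nat" where
  "num_nct n = card (noncrossing_trees n)"

definition num_nct_root1 :: "nat \<Rightarrow> nat" where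
  "num_nct_root1 n = card {E \<in> noncrossing_trees n. degree_in E 1 = 1}"

text \<open>Translation by \<open>k\<close> modulo \<open>n\<close>, with \<open>{1..n}\<close> as the set of representatives.\<close>

definition rot_vertex :: "nat \<Rightarrow> nat \<Rightarrow> nat \<Rightarrow> nat" where
  "rot_vertex n k j = (j + k - 1) mod n + 1"

definition rot_tree :: "nat \<Rightarrow> nat \<Rightarrow> nat set set \<Rightarrow> nat set set" where
  "rot_tree n k E = (\<lambda>e. rot_vertex n k ` e) ` E"

definition rot_orbit :: "nat \<Rightarrow> nat set set \<Rightarrow> nat set set set" where
  "rot_orbit n E = {rot_tree n k E | k. True}"

definition num_nct_rot :: "nat \<Rightarrow> nat" where
  "num_nct_rot n = card (rot_orbit n ` noncrossing_trees n)"

lemma finite_noncrossing_trees: "finite (noncrossing_trees n)"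
proof (rule finite_subset)
  show "noncrossing_trees n \<subseteq> Pow (Pow {1..n})"
    by (auto simp: noncrossing_trees_def is_tree_def simple_graph_def)
qed simp

end

(*
  By Burnside's lemma, n times the number of rotation classes is the number of pairs (E, k) with
  0 <= k < n and E fixed by the rotation by k. If such a rotation is nontrivial it acts without
  fixed vertices; if no edge were a diameter it would also act freely on the n - 1 edges, and its
  order would divide both n and n - 1. So E contains a diameter, which is unique because two
  diameters cross, and hence is mapped to itself: n is even and k = n / 2. Such a tree is
  determined by its diameter (n / 2 choices) and by one of its halves, a noncrossing tree on
  M = n / 2 + 1 vertices that contains the edge {1, M}. Removing this edge leaves noncrossing
  trees on {1..k} and {k+1..M}. In the same way, a tree whose root is a leaf attached to k + 1
  consists of trees on {2..k+1} and {k+1..M}, so both kinds of trees are counted by the sum of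
  A(k) A(M - k) over 1 <= k < M.
*)

theory Submission
  imports Defs
begin

section \<open>Connected graphs and trees\<close>

text \<open>Two descriptions of noncrossing have to coexist. Rotation invariance is visible in the
  geometric one, where a rotation is an injective linear map of the plane; relabelling breaks the
  linear order of the labels where they wrap around. Cutting and gluing along intervals needs the
  order-theoretic one, \<open>crossing_free\<close>, which mentions neither n nor the plane. Signs
  of orientation determinants show that they agree. Trees are handled by a count: connected, with
  one more vertex than edges. No connected graph has fewer edges than that, so two connected pieces
  with the right total are both trees. That deleting \<open>{1, M}\<close> leaves two intervals is a
  use of planarity: a gap in one component lies below one of its edges and is cut off from the other
  component. An edge fixed by a nontrivial rotation must be a diameter because its ends, not being
  fixed, are exchanged, so twice the rotation is trivial.\<close>

abbreviation reach :: "'a set set \<Rightarrow> ('a \<times> 'a) set" where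
  "reach E \<equiv> {(x, y). {x, y} \<in> E}\<^sup>*"

text \<open>Acyclicity is encoded by an edge count, which is easy to follow through restriction,
  gluing and injective relabelling, whereas cycles are not.\<close>

definition edge_tree :: "'a set \<Rightarrow> 'a set set \<Rightarrow> bool" where
  "edge_tree V E \<longleftrightarrow> simple_graph V E \<and> connected_graph V E \<and> card V = Suc (card E)"

lemma simple_graph_finite_edges: "simple_graph V E \<Longrightarrow> finite E"
  unfolding simple_graph_def by (meson Pow_iff finite_Pow_iff finite_subset subsetI)

lemma simple_graph_edge:
  assumes "simple_graph V E" "{a, b} \<in> E"
  shows "a \<in> V" "b \<in> V" "a \<noteq> b"
proof -
  have "{a, b} \<subseteq> V" "card {a, b} = 2" using assms by (auto simp: simple_graph_def)
  then show "a \<in> V" "b \<in> V" "a \<noteq> b" by auto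
qed

lemma simple_graph_edgeE:
  assumes "simple_graph V E" "e \<in> E"
  obtains a b where "e = {a, b}" "a \<noteq> b" "a \<in> V" "b \<in> V"
proof -
  have "card e = 2" "e \<subseteq> V" using assms by (auto simp: simple_graph_def)
  then obtain a b where "e = {a, b}" "a \<noteq> b" by (meson card_2_iff)
  with \<open>e \<subseteq> V\<close> show ?thesis using that by blast
qed

lemma reach_edge: "{x, y} \<in> E \<Longrightarrow> (x, y) \<in> reach E"
  by auto

lemma reach_sym: "(x, y) \<in> reach E \<Longrightarrow> (y, x) \<in> reach E"
proof -
  have "sym {(x, y). {x, y} \<in> E}" by (auto simp: sym_def insert_commute)
  then show "(x, y) \<in> reach E \<Longrightarrow> (y, x) \<in> reach E" by (meson sym_rtrancl symD)
qed

lemma reach_map: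
  assumes "(x, y) \<in> reach E"
    and "\<And>u v. {u, v} \<in> E \<Longrightarrow> (f u, f v) \<in> reach F"
  shows "(f x, f y) \<in> reach F"
  using assms(1) 
proof induction
  case (step y z)
  then have "(f y, f z) \<in> reach F" using assms(2) by simp
  with step.IH show ?case by (rule rtrancl_trans)
qed simp

lemma reach_mono: "(x, y) \<in> reach E \<Longrightarrow> E \<subseteq> F \<Longrightarrow> (x, y) \<in> reach F"
  using reach_map[of x y E "\<lambda>x. x" F] by auto

text \<open>A path from inside \<open>S\<close> to outside has an edge leaving \<open>S\<close>.
  Knowing that \<open>u\<close> is still reachable from \<open>x\<close> places this edge in the
  component of \<open>x\<close>, as planarity arguments require.\<close>

lemma reach_leaves:
  assumes "(x, y) \<in> reach E" "x \<in> S" "y \<notin> S"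
  obtains u v where "{u, v} \<in> E" "u \<in> S" "v \<notin> S" "(x, u) \<in> reach E"
  using assms by (induction arbitrary: thesis) blast+

text \<open>Edges may be collapsed to a point or stretched to a path, so \<open>f\<close> can be a
  retraction of a tree onto one of its pieces.\<close>

lemma connected_graph_map:
  assumes "connected_graph V E" "W \<subseteq> f ` V" "W \<noteq> {}"
    and "\<And>u v. {u, v} \<in> E \<Longrightarrow> (f u, f v) \<in> reach F"
  shows "connected_graph W F"
  unfolding connected_graph_def
proof (intro conjI ballI)
  fix x y assume "x \<in> W" "y \<in> W"
  then obtain u v where uv: "u \<in> V" "v \<in> V" "x = f u" "y = f v" using assms(2) by blast
  then have "(u, v) \<in> reach E" using assms(1) by (auto simp: connected_graph_def)
  then show "(x, y) \<in> reach F" using reach_map assms(4) uv by metis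
qed (fact assms)

lemma connected_graph_from:
  assumes "r \<in> V" "\<And>v. v \<in> V \<Longrightarrow> (r, v) \<in> reach E"
  shows "connected_graph V E"
  unfolding connected_graph_def
proof (intro conjI ballI)
  fix u v assume "u \<in> V" "v \<in> V"
  then show "(u, v) \<in> reach E" 
    using rtrancl_trans[OF reach_sym[OF assms(2)] assms(2)] by simp
qed (use assms(1) in auto)

lemma connected_graph_Un:
  assumes "connected_graph V E" "connected_graph W F" "V \<inter> W \<noteq> {}"
  shows "connected_graph (V \<union> W) (E \<union> F)"
proof -
  obtain r where r: "r \<in> V" "r \<in> W" using assms(3) by blast
  show ?thesis
  proof (rule connected_graph_from)
    show "r \<in> V \<union> W" using r by simp
    fix v assume "v \<in> V \<union> W"
    then show "(r, v) \<in> reach (E \<union> F)"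
    proof
      assume "v \<in> V"
      then have "(r, v) \<in> reach E" using assms(1) r by (simp add: connected_graph_def)
      then show ?thesis by (rule reach_mono) simp
    next
      assume "v \<in> W"
      then have "(r, v) \<in> reach F" using assms(2) r by (simp add: connected_graph_def)
      then show ?thesis by (rule reach_mono) simp
    qed
  qed
qed

lemma connected_graph_edge: "connected_graph {a, b} {{a, b}}"
  by (rule connected_graph_from[of a]) (auto intro: r_into_rtrancl)

text \<open>Sending each vertex other than a fixed root to the last edge of a shortest path from
  the root is injective.\<close>

lemma connected_graph_card_le:
  assumes "finite E" "connected_graph V E"
  shows "card V \<le> Suc (card E)"
proof -
  let ?R = "{(x, y). {x, y} \<in> E}"
  obtain r where r: "r \<in> V" using assms(2) by (auto simp: connected_graph_def)
  define d where "d v = (LEAST k. (r, v) \<in> ?R ^^ k)" for v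
  have "\<exists>u. {u, v} \<in> E \<and> d v = Suc (d u)" if "v \<in> V - {r}" for v
  proof -
    have "(r, v) \<in> reach E" using assms(2) r that by (auto simp: connected_graph_def)
    then obtain l where "(r, v) \<in> ?R ^^ l" using rtrancl_imp_relpow by blast
    then have dv: "(r, v) \<in> ?R ^^ d v" unfolding d_def by (rule LeastI)
    moreover have "d v \<noteq> 0"
    proof
      assume "d v = 0"
      with dv show False using that by simp
    qed
    ultimately obtain k where k: "d v = Suc k" "(r, v) \<in> ?R ^^ Suc k"
      using not0_implies_Suc by metis
    then obtain u where u: "(r, u) \<in> ?R ^^ k" "{u, v} \<in> E" by auto
    have du: "(r, u) \<in> ?R ^^ d u" unfolding d_def using u(1) by (rule LeastI)
    then have "(r, v) \<in> ?R ^^ Suc (d u)" using u(2) by auto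
    then have "d v \<le> Suc (d u)" unfolding d_def[of v] by (rule Least_le)
    moreover have "d u \<le> k" unfolding d_def using u(1) by (rule Least_le)
    ultimately show ?thesis using k u by auto
  qed
  then obtain p where p: "\<And>v. v \<in> V - {r} \<Longrightarrow> {p v, v} \<in> E \<and> d v = Suc (d (p v))" by metis
  have "inj_on (\<lambda>v. {p v, v}) (V - {r})"
  proof (rule inj_onI)
    fix v w assume vw: "v \<in> V - {r}" "w \<in> V - {r}" "{p v, v} = {p w, w}"
    show "v = w"
    proof (rule ccontr)
      assume "v \<noteq> w"
      \<comment> \<open>Each vertex would be the predecessor of the other, and the distance would
        grow by one in both directions.\<close>
      then have "v = p w" "w = p v" using vw(3) by (auto simp: doubleton_eq_iff)
      then show False using p[OF vw(1)] p[OF vw(2)] by simp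
    qed
  qed
  then have "card (V - {r}) \<le> card E"
    by (rule card_inj_on_le) (use p assms(1) in auto)
  then show ?thesis using r by (simp add: card_Diff_singleton_if)
qed

text \<open>The closing edge of the cycle can be spared, since the rest of the cycle still joins its
  two ends.\<close>

lemma connected_graph_remove_cycle_edge:
  assumes "connected_graph V E" "is_cycle E vs"
  shows "\<exists>e\<in>E. connected_graph V (E - {e})"
proof -
  let ?l = "length vs"
  have l: "3 \<le> ?l" "distinct vs"
    and c: "\<And>i. i < ?l \<Longrightarrow> {vs ! i, vs ! (Suc i mod ?l)} \<in> E"
    using assms(2) by (auto simp: is_cycle_def)
  have "vs \<noteq> []" using l(1) by auto
  define e where "e = {vs ! (?l - 1), vs ! 0}"
  have "Suc (?l - 1) mod ?l = 0" using l(1) by (cases vs) auto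
  then have e: "e \<in> E" using c[of "?l - 1"] l(1) by (auto simp: e_def)
  have path: "(vs ! 0, vs ! i) \<in> reach (E - {e})" if "i < ?l" for i
    using that
  proof (induction i)
    case (Suc i)
    have "{vs ! i, vs ! Suc i} \<in> E" using c[of i] Suc.prems by simp
    moreover have "{vs ! i, vs ! Suc i} \<noteq> e"
    proof
      assume "{vs ! i, vs ! Suc i} = e"
      then consider "vs ! i = vs ! (?l - 1)" | "vs ! i = vs ! 0" "vs ! Suc i = vs ! (?l - 1)"
        unfolding e_def doubleton_eq_iff by blast
      then show False
      proof cases
        case 1
        then have "i = ?l - 1"
          using nth_eq_iff_index_eq[OF l(2), of i "?l - 1"] Suc.prems by simp
        then show False using Suc.prems by simp
      next
        case 2
        \<comment> \<open>Both equations together force a list of length two, too short for a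
          cycle.\<close>
        have "i = 0" "Suc i = ?l - 1"
          using nth_eq_iff_index_eq[OF l(2), of i 0] 2(1) Suc.prems \<open>vs \<noteq> []\<close>
            nth_eq_iff_index_eq[OF l(2), of "Suc i" "?l - 1"] 2(2) by simp_all
        then show False using l(1) by simp
      qed
    qed
    ultimately have "(vs ! i, vs ! Suc i) \<in> {(x, y). {x, y} \<in> E - {e}}" by simp
    moreover have "(vs ! 0, vs ! i) \<in> reach (E - {e})" using Suc by simp
    ultimately show ?case by (rule rtrancl_into_rtrancl[rotated])
  qed simp
  then have "(vs ! 0, vs ! (?l - 1)) \<in> reach (E - {e})" using l(1) by simp
  note ends = this reach_sym[OF this]
  have "connected_graph V (E - {e})"
  proof (rule connected_graph_map[OF assms(1), of _ "\<lambda>x. x"])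
    fix u v assume "{u, v} \<in> E"
    show "(u, v) \<in> reach (E - {e})"
    proof (cases "{u, v} = e")
      case True
      then consider "u = vs ! (?l - 1)" "v = vs ! 0" | "u = vs ! 0" "v = vs ! (?l - 1)"
        unfolding e_def doubleton_eq_iff by blast
      then show ?thesis using ends by cases (simp only:)+
    next
      case False
      with \<open>{u, v} \<in> E\<close> show ?thesis by auto
    qed
  qed (use assms(1) in \<open>auto simp: connected_graph_def\<close>)
  with e show ?thesis by blast
qed

text \<open>A cycle would leave room to delete an edge and stay connected, below the minimal number
  of edges. In the other direction connectedness makes \<open>V\<close> nonempty, so the truncated
  \<open>card V - 1\<close> can be inverted.\<close>

lemma edge_tree_iff_is_tree:
  "edge_tree V E \<longleftrightarrow> is_tree V E \<and> card E = card V - 1"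
proof
  assume t: "edge_tree V E"
  then have s: "simple_graph V E" "connected_graph V E" "card V = Suc (card E)"
    by (auto simp: edge_tree_def)
  have fin: "finite E" using s(1) by (rule simple_graph_finite_edges)
  have False if cycle: "is_cycle E vs" for vs
  proof -
    obtain e where e: "e \<in> E" "connected_graph V (E - {e})"
      using connected_graph_remove_cycle_edge[OF s(2) cycle] by blast
    then have "card V \<le> Suc (card (E - {e}))" using connected_graph_card_le fin by blast
    moreover have "card (E - {e}) < card E" using e(1) fin by (meson card_Diff1_less)
    ultimately show False using s(3) by simp
  qed
  then show "is_tree V E \<and> card E = card V - 1" using s by (auto simp: is_tree_def)
next
  assume "is_tree V E \<and> card E = card V - 1"
  moreover from this have "card V \<noteq> 0"
    by (auto simp: is_tree_def connected_graph_def simple_graph_def)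
  ultimately show "edge_tree V E" by (auto simp: edge_tree_def is_tree_def)
qed

lemma edge_tree_image:
  assumes "edge_tree V E" "inj_on f V"
  shows "edge_tree (f ` V) ((\<lambda>e. f ` e) ` E)"
proof -
  have s: "simple_graph V E" "connected_graph V E" "card V = Suc (card E)"
    using assms(1) by (auto simp: edge_tree_def)
  have sub: "E \<subseteq> Pow V" using s(1) by (auto simp: simple_graph_def)
  have "inj_on (\<lambda>e. f ` e) E" using inj_on_image_Pow[OF assms(2)] sub by (rule inj_on_subset)
  then have "card ((\<lambda>e. f ` e) ` E) = card E" by (rule card_image)
  moreover have "card (f ` V) = card V" using assms(2) by (rule card_image)
  moreover have "simple_graph (f ` V) ((\<lambda>e. f ` e) ` E)"
    using s(1) assms(2) by (fastforce simp: simple_graph_def card_image inj_on_subset)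
  moreover have "connected_graph (f ` V) ((\<lambda>e. f ` e) ` E)"
  proof (rule connected_graph_map[OF s(2), of _ f])
    fix u v assume "{u, v} \<in> E"
    then have "f ` {u, v} \<in> (\<lambda>e. f ` e) ` E" by (rule imageI)
    then show "(f u, f v) \<in> reach ((\<lambda>e. f ` e) ` E)" by auto
  qed (use s(2) in \<open>auto simp: connected_graph_def\<close>)
  ultimately show ?thesis using s(3) by (simp add: edge_tree_def)
qed

section \<open>Crossing chords\<close>

text \<open>An unordered edge matches \<open>{a, b}\<close> in both ways and the two edges may be
  exchanged, so this single pattern covers every interleaving of endpoints.\<close>

definition crossing_free :: "nat set set \<Rightarrow> bool" where
  "crossing_free E \<longleftrightarrow>
     (\<forall>a b c d. {a, b} \<in> E \<longrightarrow> {c, d} \<in> E \<longrightarrow> \<not> (a < c \<and> c < b \<and> b < d))"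

text \<open>Twice the signed area of the triangle p, q, z: positive if z lies to the left of the
  line from p to q, zero on the line.\<close>

definition orient :: "complex \<Rightarrow> complex \<Rightarrow> complex \<Rightarrow> real" where
  "orient p q z = (Re q - Re p) * (Im z - Im p) - (Im q - Im p) * (Re z - Re p)"

text \<open>On the unit circle the area factors into sines of half the angular differences, so its
  sign can be read off from the order of the angles. Product-to-sum formulas give the
  identity.\<close>

lemma orient_cis:
  "orient (cis x) (cis y) (cis z) = 4 * sin ((y - x) / 2) * sin ((z - y) / 2) * sin ((z - x) / 2)"
proof -
  define a b c where "a = x / 2" and "b = y / 2" and "c = z / 2"
  have xyz: "x = 2 * a" "y = 2 * b" "z = 2 * c" by (auto simp: a_def b_def c_def)
  have "4 * sin (b - a) * sin (c - b) * sin (c - a) =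
      2 * (cos (b - a - (c - b)) - cos (b - a + (c - b))) * sin (c - a)"
    using sin_times_sin[of "b - a" "c - b"] by simp
  also have "\<dots> = sin (2 * b - 2 * a) + sin (2 * c - 2 * b) - sin (2 * c - 2 * a)"
  proof -
    have "2 * (cos (2 * b - a - c) * sin (c - a)) = sin (2 * b - 2 * a) + sin (2 * c - 2 * b)"
      using cos_times_sin[of "2 * b - a - c" "c - a"] sin_minus[of "2 * c - 2 * b"]
      by (simp add: algebra_simps)
    moreover have "2 * (cos (c - a) * sin (c - a)) = sin (2 * c - 2 * a)"
      using sin_double[of "c - a"] by (simp add: right_diff_distrib)
    ultimately show ?thesis by (simp add: algebra_simps)
  qed
  also have "\<dots> = orient (cis (2 * a)) (cis (2 * b)) (cis (2 * c))"
    by (simp add: orient_def sin_diff algebra_simps)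
  finally have "4 * sin (b - a) * sin (c - b) * sin (c - a) =
      orient (cis (2 * a)) (cis (2 * b)) (cis (2 * c))" .
  moreover have "b - a = (y - x) / 2" "c - b = (z - y) / 2" "c - a = (z - x) / 2"
    by (simp_all add: xyz)
  ultimately show ?thesis by (simp add: xyz)
qed

lemma orient_combination:
  "orient p q ((1 - u) *\<^sub>R z + u *\<^sub>R w) = (1 - u) * orient p q z + u * orient p q w"
  by (simp add: orient_def algebra_simps)

lemma orient_vertex:
  "orient (vertex_point n a) (vertex_point n b) (vertex_point n c) =
    4 * sin ((real b - real a) * pi / n) * sin ((real c - real b) * pi / n)
      * sin ((real c - real a) * pi / n)"
proof -
  have "((real j - 1) * (2 * pi) / real n - (real i - 1) * (2 * pi) / real n) / 2
    = (real j - real i) * pi / n" for i j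
    by (cases "n = 0") (simp_all add: field_simps)
  then show ?thesis unfolding vertex_point_def orient_cis by simp
qed

lemma sin_vertex_pos:
  assumes "a < b" "a \<in> {1..n}" "b \<in> {1..n}"
  shows "0 < sin ((real b - real a) * pi / n)"
proof (rule sin_gt_zero)
  show "0 < (real b - real a) * pi / n" using assms by simp
  have "real b - real a < real n" using assms by auto
  then have "(real b - real a) * pi < real n * pi" by simp
  then show "(real b - real a) * pi / n < pi" using assms by (simp add: field_simps)
qed

lemma orient_vertex_pos:
  assumes "a < b" "b < c" "a \<in> {1..n}" "c \<in> {1..n}"
  shows "0 < orient (vertex_point n a) (vertex_point n b) (vertex_point n c)"
  using assms sin_vertex_pos[of a b n] sin_vertex_pos[of b c n] sin_vertex_pos[of a c n]
  by (simp add: orient_vertex)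

lemma orient_swap: "orient p z q = - orient p q z" "orient z p q = orient p q z"
  by (simp_all add: orient_def algebra_simps)

lemma orient_degenerate: "orient p q p = 0" "orient p q q = 0"
  by (simp_all add: orient_def)

text \<open>The factor \<open>s\<close> selects a side of the line through p and q. A proper convex
  combination of two nonnegative numbers that are not both zero is positive, so the open segment
  from z to w stays strictly on that side, while the other segment has orientation zero.\<close>

lemma open_segments_disjointI:
  assumes "0 \<le> s * orient p q z" "0 \<le> s * orient p q w"
    and "orient p q z \<noteq> 0 \<or> orient p q w \<noteq> 0" "s \<noteq> 0"
  shows "open_segment p q \<inter> open_segment z w = {}"
proof (rule ccontr)
  assume "\<not> ?thesis"
  then obtain t where t: "t \<in> open_segment p q" "t \<in> open_segment z w" by blast
  obtain u where u: "0 < u" "u < 1" "t = (1 - u) *\<^sub>R p + u *\<^sub>R q"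
    using t(1) by (auto simp: in_segment)
  obtain v where v: "0 < v" "v < 1" "t = (1 - v) *\<^sub>R z + v *\<^sub>R w"
    using t(2) by (auto simp: in_segment)
  have "orient p q t = 0" unfolding u(3) orient_combination by (simp add: orient_degenerate)
  then have "(1 - v) * (s * orient p q z) + v * (s * orient p q w) = 0"
    unfolding v(3) orient_combination
    by (metis (no_types, lifting) mult.left_commute mult_zero_right ring_class.ring_distribs(1))
  moreover have "0 < s * orient p q z \<or> 0 < s * orient p q w"
    using assms by (metis less_eq_real_def mult_eq_0_iff)
  then have "0 < (1 - v) * (s * orient p q z) + v * (s * orient p q w)"
    using assms(1,2) v(1,2)
    by (metis add_nonneg_pos add_pos_nonneg diff_gt_0_iff_gt less_imp_le mult_nonneg_nonneg mult_pos_pos)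
  ultimately show False by simp
qed

text \<open>The barycentric weights are the areas of the four triangles cut out of a convex
  quadrilateral by its diagonals.\<close>

lemma open_segments_meetI:
  assumes "0 < orient a c b" "0 < orient c b d" "0 < orient a b d" "0 < orient a c d"
  shows "open_segment a b \<inter> open_segment c d \<noteq> {}"
proof -
  \<comment> \<open>Twice the area of the quadrilateral a, c, b, d, cut along the diagonal c d; the
    next line cuts it along a b.\<close>
  define S where "S = orient c b d + orient a c d"
  have S: "0 < S" "S = orient a b d + orient a c b"
    using assms by (auto simp: S_def orient_def algebra_simps)
  define u where "u = orient a c d / S"
  define v where "v = orient a c b / S"
  have uv: "0 < u" "u < 1" "0 < v" "v < 1"
    using assms S by (auto simp: u_def v_def S_def)
  have u1: "1 - u = orient c b d / S" using S(1) by (simp add: u_def S_def field_simps)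
  have v1: "1 - v = orient a b d / S" using S by (simp add: v_def field_simps)
  have "orient c b d *\<^sub>R a + orient a c d *\<^sub>R b = orient a b d *\<^sub>R c + orient a c b *\<^sub>R d"
    by (simp add: complex_eq_iff orient_def algebra_simps)
  then have "(1 / S) *\<^sub>R (orient c b d *\<^sub>R a + orient a c d *\<^sub>R b)
      = (1 / S) *\<^sub>R (orient a b d *\<^sub>R c + orient a c b *\<^sub>R d)" by simp
  then have "(1 - u) *\<^sub>R a + u *\<^sub>R b = (1 - v) *\<^sub>R c + v *\<^sub>R d"
    unfolding u1 v1 by (simp add: u_def v_def scaleR_right_distrib)
  moreover have "a \<noteq> b" "c \<noteq> d" using assms by (auto simp: orient_def)
  ultimately show ?thesis using uv by (fastforce simp: in_segment)
qed

lemma chords_cross: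
  assumes "a < c" "c < b" "b < d" "a \<in> {1..n}" "d \<in> {1..n}"
  shows "open_segment (vertex_point n a) (vertex_point n b) \<inter>
    open_segment (vertex_point n c) (vertex_point n d) \<noteq> {}"
  using assms by (intro open_segments_meetI orient_vertex_pos) auto

lemma orient_vertex_nonneg:
  assumes "a \<le> b" "b \<le> c" "a \<in> {1..n}" "c \<in> {1..n}"
  shows "0 \<le> orient (vertex_point n a) (vertex_point n b) (vertex_point n c)"
    and "a < b \<Longrightarrow> b < c \<Longrightarrow> orient (vertex_point n a) (vertex_point n b) (vertex_point n c) \<noteq> 0"
  using assms orient_vertex_pos[of a b c n]
  by (cases "a = b"; cases "b = c"; force simp: orient_def)+

lemma chords_disjoint:
  assumes "a < b" "c < d" "{a, b, c, d} \<subseteq> {1..n}" "a \<noteq> c \<or> b \<noteq> d"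
    and "\<not> (a < c \<and> c < b \<and> b < d)" "\<not> (c < a \<and> a < d \<and> d < b)"
  shows "open_segment (vertex_point n a) (vertex_point n b) \<inter>
    open_segment (vertex_point n c) (vertex_point n d) = {}"
proof -
  let ?o = "\<lambda>j. orient (vertex_point n a) (vertex_point n b) (vertex_point n j)"
  \<comment> \<open>Labels between \<open>a\<close> and \<open>b\<close> lie to the right of the
    chord, all others to its left, and only the two ends lie on it.\<close>
  have ins: "0 \<le> - 1 * ?o j" "a < j \<Longrightarrow> j < b \<Longrightarrow> ?o j \<noteq> 0" if "a \<le> j" "j \<le> b" for j
    using orient_vertex_nonneg[of a j b n] that assms(3)
      orient_swap(1)[of "vertex_point n a" "vertex_point n j" "vertex_point n b"] by auto
  have out: "0 \<le> 1 * ?o j" "j < a \<or> b < j \<Longrightarrow> ?o j \<noteq> 0" if "j \<le> a \<or> b \<le> j" "j \<in> {1..n}" for j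
    using orient_vertex_nonneg[of a b j n] orient_vertex_nonneg[of j a b n] that assms(1,3)
      orient_swap(2)[of "vertex_point n j" "vertex_point n a" "vertex_point n b"] by auto
  \<comment> \<open>Once interleaving is excluded, both ends of the second chord are on the same
    closed side of the first.\<close>
  consider "a \<le> c" "d \<le> b" | "c \<le> a \<or> b \<le> c" "d \<le> a \<or> b \<le> d"
    using assms by linarith
  then show ?thesis
  proof cases
    case 1
    then have "a < c \<and> c < b \<or> a < d \<and> d < b" using assms by linarith
    then show ?thesis
      using ins[of c] ins[of d] 1 assms(1,2)
      by (intro open_segments_disjointI[of "- 1"]) linarith+
  next
    case 2
    then have "c < a \<or> b < c \<or> d < a \<or> b < d" using assms by linarith
    then show ?thesis
      using out[of c] out[of d] 2 assms(3)
      by (intro open_segments_disjointI[of 1]) auto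
  qed
qed

text \<open>The bridge between the geometric definition, used for rotations, and the order
  condition, used for cutting and gluing.\<close>

lemma noncrossing_iff_crossing_free:
  assumes "simple_graph {1..n} E"
  shows "noncrossing n E \<longleftrightarrow> crossing_free E"
proof
  assume nc: "noncrossing n E"
  show "crossing_free E"
    unfolding crossing_free_def
  proof (intro allI impI notI, elim conjE)
    fix a b c d assume e: "{a, b} \<in> E" "{c, d} \<in> E" and *: "a < c" "c < b" "b < d"
    have "{a, b} \<noteq> {c, d}" using * by (auto simp: doubleton_eq_iff)
    moreover have "a \<in> {1..n}" "d \<in> {1..n}" using e assms by (auto simp: simple_graph_def)
    ultimately show False using nc chords_cross[OF *, of n] e unfolding noncrossing_def by blast
  qed
next
  assume cf: "crossing_free E"
  have main: "open_segment (vertex_point n a) (vertex_point n b) \<inter>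
      open_segment (vertex_point n c) (vertex_point n d) = {}"
    if "{a, b} \<in> E" "{c, d} \<in> E" "{a, b} \<noteq> {c, d}" "a < b" "c < d" for a b c d
  proof (rule chords_disjoint)
    show "{a, b, c, d} \<subseteq> {1..n}" using that assms by (auto simp: simple_graph_def)
    show "\<not> (a < c \<and> c < b \<and> b < d)" "\<not> (c < a \<and> a < d \<and> d < b)"
      using cf that(1,2) by (auto simp: crossing_free_def)
  qed (use that in auto)
  show "noncrossing n E"
    unfolding noncrossing_def
  proof (intro allI impI)
    fix a b c d assume e: "{a, b} \<in> E" "{c, d} \<in> E" "{a, b} \<noteq> {c, d}"
    have "card {a, b} = 2" "card {c, d} = 2" using e assms by (auto simp: simple_graph_def)
    then have "a \<noteq> b" "c \<noteq> d" by auto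
    then consider "a < b" "c < d" | "a < b" "d < c" | "b < a" "c < d" | "b < a" "d < c" by linarith
    then show "open_segment (vertex_point n a) (vertex_point n b) \<inter>
      open_segment (vertex_point n c) (vertex_point n d) = {}"
      by cases (use e main[of a b c d] main[of a b d c] main[of b a c d] main[of b a d c] in
        \<open>auto simp: insert_commute open_segment_commute\<close>)
  qed
qed

section \<open>Splitting noncrossing trees\<close>

text \<open>The vertex set is arbitrary so that pieces such as \<open>{Suc k..M}\<close> keep their
  labels and are renumbered only when counted.\<close>

definition nc_trees :: "nat set \<Rightarrow> nat set set set" where
  "nc_trees V = {E. edge_tree V E \<and> crossing_free E}"

lemma noncrossing_trees_eq: "noncrossing_trees n = nc_trees {1..n}"
  unfolding noncrossing_trees_def nc_trees_def edge_tree_iff_is_tree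
  using noncrossing_iff_crossing_free by (auto simp: is_tree_def)

lemma nc_trees_subset: "nc_trees V \<subseteq> Pow (Pow V)"
  by (auto simp: nc_trees_def edge_tree_def simple_graph_def)

lemma nc_trees_edge:
  assumes "E \<in> nc_trees V" "{a, b} \<in> E"
  shows "a \<in> V" "b \<in> V" "a \<noteq> b"
  using assms simple_graph_edge[of V E a b] by (auto simp: nc_trees_def edge_tree_def)

lemma finite_nc_trees: "finite V \<Longrightarrow> finite (nc_trees V)"
  using nc_trees_subset by (rule finite_subset) simp

lemma crossing_free_mono: "crossing_free E \<Longrightarrow> F \<subseteq> E \<Longrightarrow> crossing_free F"
  unfolding crossing_free_def by blast

lemma crossing_free_Un:
  assumes "crossing_free F" "crossing_free G"
    and "\<And>a b c d. {a, b} \<in> F \<Longrightarrow> {c, d} \<in> G \<Longrightarrow>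
      \<not> (a < c \<and> c < b \<and> b < d) \<and> \<not> (c < a \<and> a < d \<and> d < b)"
  shows "crossing_free (F \<union> G)"
  using assms unfolding crossing_free_def by blast

lemma crossing_free_edge: "crossing_free {{p, q}}"
  by (auto simp: crossing_free_def doubleton_eq_iff)

lemma image_nc_trees:
  assumes "E \<in> nc_trees V" "strict_mono_on V f"
  shows "(\<lambda>e. f ` e) ` E \<in> nc_trees (f ` V)"
proof -
  have inj: "inj_on f V" using assms(2) by (rule strict_mono_on_imp_inj_on)
  have less: "x < y" if "f x < f y" "x \<in> V" "y \<in> V" for x y
    using that assms(2) by (metis linorder_neq_iff order_less_asym strict_mono_onD)
  have pull: "\<exists>u v. {u, v} \<in> E \<and> a = f u \<and> b = f v \<and> u \<in> V \<and> v \<in> V"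
    if ab: "{a, b} \<in> (\<lambda>e. f ` e) ` E" for a b
  proof -
    obtain e where e: "e \<in> E" "{a, b} = f ` e" using ab by blast
    moreover have "simple_graph V E" using assms(1) by (simp add: nc_trees_def edge_tree_def)
    ultimately obtain u v where uv: "e = {u, v}" "u \<noteq> v" "u \<in> V" "v \<in> V"
      using simple_graph_edgeE by metis
    then have "a = f u \<and> b = f v \<or> a = f v \<and> b = f u" using e(2) by (auto simp: doubleton_eq_iff)
    then show ?thesis using e(1) uv by (metis insert_commute)
  qed
  have cf: "crossing_free E" using assms(1) by (simp add: nc_trees_def)
  have "crossing_free ((\<lambda>e. f ` e) ` E)"
    unfolding crossing_free_def
  proof (intro allI impI notI, elim conjE)
    fix a b c d
    assume *: "{a, b} \<in> (\<lambda>e. f ` e) ` E" "{c, d} \<in> (\<lambda>e. f ` e) ` E" "a < c" "c < b" "b < d"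
    obtain u v where uv: "{u, v} \<in> E" "a = f u" "b = f v" "u \<in> V" "v \<in> V"
      using pull *(1) by blast
    obtain w z where wz: "{w, z} \<in> E" "c = f w" "d = f z" "w \<in> V" "z \<in> V"
      using pull *(2) by blast
    have "u < w" "w < v" "v < z" using *(3-5) uv wz less by auto
    then show False using cf uv(1) wz(1) by (auto simp: crossing_free_def)
  qed
  then show ?thesis
    using edge_tree_image[OF _ inj] assms(1) by (simp add: nc_trees_def)
qed

text \<open>An inequality suffices: applied to an order-preserving map and to its inverse it gives
  equality, with no need to describe the image of the induced map on trees.\<close>

lemma card_nc_trees_le:
  assumes "finite V" "strict_mono_on V f"
  shows "card (nc_trees V) \<le> card (nc_trees (f ` V))"
proof (rule card_inj_on_le)
  have "inj_on f V" using assms(2) by (rule strict_mono_on_imp_inj_on)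
  then have "inj_on (\<lambda>E. (\<lambda>e. f ` e) ` E) (Pow (Pow V))"
    by (intro inj_on_image_Pow)
  then show "inj_on (\<lambda>E. (\<lambda>e. f ` e) ` E) (nc_trees V)"
    using nc_trees_subset by (rule inj_on_subset)
qed (use assms image_nc_trees in \<open>auto simp: finite_nc_trees\<close>)

lemma card_nc_trees_atLeastAtMost:
  assumes "1 \<le> i"
  shows "card (nc_trees {i..j}) = num_nct (Suc j - i)"
proof (cases "i \<le> j")
  case True
  let ?V = "{1..Suc j - i}"
  have up: "(+) (i - 1) ` ?V = {i..j}"
    using True assms unfolding image_add_atLeastAtMost by simp
  then have down: "(\<lambda>x. x - (i - 1)) ` {i..j} = ?V"
    unfolding up[symmetric] image_image by simp
  have "card (nc_trees ?V) \<le> card (nc_trees {i..j})"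
    using card_nc_trees_le[of ?V "(+) (i - 1)", unfolded up] by (simp add: strict_mono_on_def)
  moreover have "card (nc_trees {i..j}) \<le> card (nc_trees ?V)"
  proof -
    have "strict_mono_on {i..j} (\<lambda>x. x - (i - 1))"
      using assms by (intro strict_mono_onI) auto
    from card_nc_trees_le[OF _ this] show ?thesis unfolding down by simp
  qed
  ultimately show ?thesis by (simp add: num_nct_def noncrossing_trees_eq)
next
  case False
  then show ?thesis by (simp add: num_nct_def noncrossing_trees_eq)
qed

section \<open>Gluing trees and cutting them apart\<close>

lemma edge_tree_edge: "a \<noteq> b \<Longrightarrow> edge_tree {a, b} {{a, b}}"
  using connected_graph_edge by (auto simp: edge_tree_def simple_graph_def)

text \<open>A common edge would need two common vertices, so the edge counts add while the vertex
  counts overlap in one.\<close>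

lemma edge_tree_glue:
  assumes "edge_tree V F" "edge_tree W G" "V \<inter> W = {v}"
  shows "edge_tree (V \<union> W) (F \<union> G)"
proof -
  have s: "simple_graph V F" "simple_graph W G" "connected_graph V F" "connected_graph W G"
    and c: "card V = Suc (card F)" "card W = Suc (card G)"
    using assms by (auto simp: edge_tree_def)
  have "e \<notin> G" if "e \<in> F" for e
  proof
    assume "e \<in> G"
    then have "e \<subseteq> V \<inter> W" "card e = 2" using that s(1,2) by (auto simp: simple_graph_def)
    then show False using card_mono[of "{v}" e] assms(3) by simp
  qed
  then have "F \<inter> G = {}" by blast
  then have "card (F \<union> G) = card F + card G"
    using s by (simp add: card_Un_disjoint simple_graph_finite_edges)
  moreover have "card (V \<union> W) + 1 = card V + card W"
    using card_Un_Int[of V W] s assms(3) by (simp add: simple_graph_def)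
  moreover have "simple_graph (V \<union> W) (F \<union> G)" using s by (auto simp: simple_graph_def)
  moreover have "connected_graph (V \<union> W) (F \<union> G)"
    using connected_graph_Un s(3,4) assms(3) by blast
  ultimately show ?thesis using c by (simp add: edge_tree_def)
qed

text \<open>Each graph satisfies \<open>card V \<le> Suc (card E)\<close>; if the sum of these two
  bounds is attained, then so is each of them.\<close>

lemma edge_tree_pair:
  assumes "simple_graph V F" "simple_graph W G" "connected_graph V F" "connected_graph W G"
    and "card V + card W = card F + card G + 2"
  shows "edge_tree V F" "edge_tree W G"
  using assms connected_graph_card_le[of F V] connected_graph_card_le[of G W]
  by (auto simp: edge_tree_def simple_graph_finite_edges)

text \<open>A common frame for both decompositions: \<open>A k\<close> and \<open>B k\<close> carry
  the pieces and \<open>e k\<close> is the additional edge. Condition \<open>recover\<close> asks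
  only for an inequality, because exchanging the two decompositions yields the other one. Once the
  index is known, restricting to \<open>A k\<close> and \<open>B k\<close> returns the
  pieces.\<close>

lemma card_glued_trees:
  fixes A B :: "nat \<Rightarrow> nat set"
  assumes fin: "finite K" "\<And>k. finite (A k)" "\<And>k. finite (B k)"
    and AB: "\<And>k. k \<in> K \<Longrightarrow> card (A k \<inter> B k) \<le> 1"
    and e: "\<And>k. k \<in> K \<Longrightarrow> \<not> e k \<subseteq> A k" "\<And>k. k \<in> K \<Longrightarrow> \<not> e k \<subseteq> B k"
    and recover: "\<And>k l F G F' G'. \<lbrakk>k \<in> K; l \<in> K; F \<in> nc_trees (A k); G \<in> nc_trees (B k);
      F' \<in> nc_trees (A l); G' \<in> nc_trees (B l);
      insert (e k) (F \<union> G) = insert (e l) (F' \<union> G')\<rbrakk> \<Longrightarrow> k \<le> l"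
    and X: "X = (\<Union>k\<in>K. \<Union>F\<in>nc_trees (A k). \<Union>G\<in>nc_trees (B k). {insert (e k) (F \<union> G)})"
  shows "card X = (\<Sum>k\<in>K. card (nc_trees (A k)) * card (nc_trees (B k)))"
proof -
  let ?D = "SIGMA k:K. nc_trees (A k) \<times> nc_trees (B k)"
  let ?h = "\<lambda>(k, F, G). insert (e k) (F \<union> G)"
  have restrict: "insert (e k) (F \<union> G) \<inter> Pow (A k) = F" "insert (e k) (F \<union> G) \<inter> Pow (B k) = G"
    if "k \<in> K" "F \<in> nc_trees (A k)" "G \<in> nc_trees (B k)" for k F G
  proof -
    have FG: "F \<subseteq> Pow (A k)" "G \<subseteq> Pow (B k)" using that(2,3) nc_trees_subset by auto
    have two: "card x = 2" if "x \<in> F \<union> G" for x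
      using that \<open>F \<in> _\<close> \<open>G \<in> _\<close> by (auto simp: nc_trees_def edge_tree_def simple_graph_def)
    \<comment> \<open>An edge has two ends and the vertex sets share at most one, so no edge can
      belong to both pieces.\<close>
    have "\<not> x \<subseteq> A k \<inter> B k" if "x \<in> F \<union> G" for x
    proof
      assume "x \<subseteq> A k \<inter> B k"
      then have "card x \<le> 1" using AB[OF \<open>k \<in> K\<close>] card_mono[of "A k \<inter> B k" x] fin(2) by fastforce
      then show False using two[OF that] by simp
    qed
    then show "insert (e k) (F \<union> G) \<inter> Pow (A k) = F" "insert (e k) (F \<union> G) \<inter> Pow (B k) = G"
      using FG e[OF that(1)] by blast+
  qed
  have "inj_on ?h ?D"
  proof (rule inj_onI)
    fix x y assume "x \<in> ?D" "y \<in> ?D" "?h x = ?h y"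
    moreover obtain k F G where x: "x = (k, F, G)" by (cases x)
    moreover obtain l F' G' where y: "y = (l, F', G')" by (cases y)
    ultimately have *: "k \<in> K" "F \<in> nc_trees (A k)" "G \<in> nc_trees (B k)"
      "l \<in> K" "F' \<in> nc_trees (A l)" "G' \<in> nc_trees (B l)"
      "insert (e k) (F \<union> G) = insert (e l) (F' \<union> G')" by auto
    have "k \<le> l" using recover[of k l F G F' G'] * by blast
    moreover have "l \<le> k" using recover[of l k F' G' F G] * by simp
    ultimately have kl: "k = l" by simp
    then show "x = y"
      using restrict[of k F G] restrict[of k F' G'] * x y by simp
  qed
  moreover have "X = ?h ` ?D"
  proof (intro equalityI subsetI)
    fix E assume "E \<in> X"
    then obtain k F G where "k \<in> K" "F \<in> nc_trees (A k)" "G \<in> nc_trees (B k)"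
      and "E = ?h (k, F, G)" unfolding X by auto
    then show "E \<in> ?h ` ?D" by (intro image_eqI[of _ _ "(k, F, G)"]) auto
  qed (auto simp: X)
  ultimately have "card X = card ?D" by (simp add: card_image)
  also have "\<dots> = (\<Sum>k\<in>K. card (nc_trees (A k) \<times> nc_trees (B k)))"
    using fin by (intro card_SigmaI) (auto simp: finite_nc_trees)
  finally show ?thesis by (simp add: card_cartesian_product)
qed

text \<open>The root edge and both trees meet in \<open>Suc k\<close>. The tree \<open>F\<close>
  lies under the root edge and \<open>G\<close> beyond its end, so nothing interleaves.\<close>

lemma glue_at_root:
  assumes "k \<in> {1..<M}" "F \<in> nc_trees {2..Suc k}" "G \<in> nc_trees {Suc k..M}"
  shows "insert {1, Suc k} (F \<union> G) \<in> nc_trees {1..M}"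
proof -
  have "edge_tree ({1, Suc k} \<union> {2..Suc k}) ({{1, Suc k}} \<union> F)"
    by (rule edge_tree_glue[of _ _ _ _ "Suc k"])
      (use assms edge_tree_edge[of 1 "Suc k"] in \<open>auto simp: nc_trees_def\<close>)
  then have "edge_tree (({1, Suc k} \<union> {2..Suc k}) \<union> {Suc k..M}) (({{1, Suc k}} \<union> F) \<union> G)"
    by (rule edge_tree_glue[of _ _ _ _ "Suc k"]) (use assms in \<open>auto simp: nc_trees_def\<close>)
  moreover have "({1, Suc k} \<union> {2..Suc k}) \<union> {Suc k..M} = {1..M}" using assms(1) by auto
  moreover have "crossing_free ({{1, Suc k}} \<union> (F \<union> G))"
  proof (intro crossing_free_Un crossing_free_edge)
    show "crossing_free F" "crossing_free G" using assms by (auto simp: nc_trees_def)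
  next
    fix a b c d assume "{a, b} \<in> F" "{c, d} \<in> G"
    then have "a \<le> Suc k" "b \<le> Suc k" "Suc k \<le> c" "Suc k \<le> d"
      using nc_trees_edge assms by (meson atLeastAtMost_iff)+
    then show "\<not> (a < c \<and> c < b \<and> b < d) \<and> \<not> (c < a \<and> a < d \<and> d < b)" by linarith
  next
    fix a b c d assume "{a, b} \<in> {{1, Suc k}}" and cd: "{c, d} \<in> F \<union> G"
    then have "a = 1 \<and> b = Suc k \<or> a = Suc k \<and> b = 1" by (auto simp: doubleton_eq_iff)
    moreover have "2 \<le> c \<and> 2 \<le> d \<and> c \<le> Suc k \<and> d \<le> Suc k \<or> Suc k \<le> c \<and> Suc k \<le> d"
      using cd nc_trees_edge[OF assms(2)] nc_trees_edge[OF assms(3)] by fastforce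
    ultimately show "\<not> (a < c \<and> c < b \<and> b < d) \<and> \<not> (c < a \<and> a < d \<and> d < b)"
      using assms(1) by auto
  qed
  ultimately show ?thesis by (simp add: nc_trees_def)
qed

text \<open>The edge \<open>{1, M}\<close> bridges two disjoint intervals, meeting \<open>F\<close>
  in 1 and \<open>G\<close> in \<open>M\<close>. It spans all labels and hence crosses
  nothing.\<close>

lemma glue_at_last:
  assumes "k \<in> {1..<M}" "F \<in> nc_trees {1..k}" "G \<in> nc_trees {Suc k..M}"
  shows "insert {1, M} (F \<union> G) \<in> nc_trees {1..M}"
proof -
  have "edge_tree ({1, M} \<union> {1..k}) ({{1, M}} \<union> F)"
    by (rule edge_tree_glue[of _ _ _ _ 1])
      (use assms edge_tree_edge[of 1 M] in \<open>auto simp: nc_trees_def\<close>)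
  then have "edge_tree (({1, M} \<union> {1..k}) \<union> {Suc k..M}) (({{1, M}} \<union> F) \<union> G)"
    by (rule edge_tree_glue[of _ _ _ _ M]) (use assms in \<open>auto simp: nc_trees_def\<close>)
  moreover have "({1, M} \<union> {1..k}) \<union> {Suc k..M} = {1..M}" using assms(1) by auto
  moreover have "crossing_free ({{1, M}} \<union> (F \<union> G))"
  proof (intro crossing_free_Un crossing_free_edge)
    show "crossing_free F" "crossing_free G" using assms by (auto simp: nc_trees_def)
  next
    fix a b c d assume "{a, b} \<in> F" "{c, d} \<in> G"
    then have "a \<le> k" "b \<le> k" "Suc k \<le> c" "Suc k \<le> d"
      using nc_trees_edge assms by (meson atLeastAtMost_iff)+
    then show "\<not> (a < c \<and> c < b \<and> b < d) \<and> \<not> (c < a \<and> a < d \<and> d < b)" by linarith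
  next
    fix a b c d assume "{a, b} \<in> {{1, M}}" and cd: "{c, d} \<in> F \<union> G"
    then have "a = 1 \<and> b = M \<or> a = M \<and> b = 1" by (auto simp: doubleton_eq_iff)
    moreover have "1 \<le> c" "c \<le> M" "1 \<le> d" "d \<le> M"
      using cd nc_trees_edge[OF assms(2)] nc_trees_edge[OF assms(3)] assms(1) by fastforce+
    ultimately show "\<not> (a < c \<and> c < b \<and> b < d) \<and> \<not> (c < a \<and> a < d \<and> d < b)"
      using assms(1) by auto
  qed
  ultimately show ?thesis by (simp add: nc_trees_def)
qed

lemma split_at_root:
  assumes E: "E \<in> nc_trees {1..M}" and root: "{e \<in> E. 1 \<in> e} = {{1, Suc k}}" and k: "k \<in> {1..<M}"
  shows "\<exists>F\<in>nc_trees {2..Suc k}. \<exists>G\<in>nc_trees {Suc k..M}. E = insert {1, Suc k} (F \<union> G)"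
proof -
  have t: "simple_graph {1..M} E" "connected_graph {1..M} E" "card {1..M} = Suc (card E)"
    and cf: "crossing_free E" using E by (auto simp: nc_trees_def edge_tree_def)
  define F where "F = E \<inter> Pow {2..Suc k}"
  define G where "G = E \<inter> Pow {Suc k..M}"
  have edge: "{1, Suc k} \<in> E" using root by blast
  have cases: "{a, b} = {1, Suc k} \<or> {a, b} \<in> F \<or> {a, b} \<in> G" if ab: "{a, b} \<in> E" for a b
  proof (cases "1 \<in> {a, b}")
    case True
    then have "{a, b} \<in> {e \<in> E. 1 \<in> e}" using ab by simp
    then show ?thesis unfolding root by simp
  next
    case False
    then have "a \<in> {2..M}" "b \<in> {2..M}"
      using simple_graph_edge[OF t(1) ab] by (auto simp: le_less)
    \<comment> \<open>An edge that avoids the root and straddles \<open>Suc k\<close> would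
      interleave with \<open>{1, Suc k}\<close>.\<close>
    moreover have "\<not> (a < Suc k \<and> Suc k < b)" "\<not> (b < Suc k \<and> Suc k < a)"
      using cf edge ab calculation unfolding crossing_free_def
      by (metis (no_types, opaque_lifting) Suc_1 Suc_le_lessD atLeastAtMost_iff insert_commute)+
    ultimately show ?thesis using ab by (auto simp: F_def G_def)
  qed
  have E_eq: "E = insert {1, Suc k} (F \<union> G)"
  proof (intro equalityI subsetI)
    fix e assume "e \<in> E"
    moreover from this obtain a b where "e = {a, b}" using simple_graph_edgeE[OF t(1)] by metis
    ultimately show "e \<in> insert {1, Suc k} (F \<union> G)" using cases[of a b] by auto
  qed (use edge in \<open>auto simp: F_def G_def\<close>)
  have notin: "{1, Suc k} \<notin> F" "{1, Suc k} \<notin> G" using k by (auto simp: F_def G_def)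
  have FG: "F \<inter> G = {}"
  proof (rule ccontr)
    assume "F \<inter> G \<noteq> {}"
    then obtain e where e: "e \<in> E" "e \<subseteq> {2..Suc k}" "e \<subseteq> {Suc k..M}"
      unfolding F_def G_def by blast
    have "x = Suc k" if "x \<in> e" for x using subsetD[OF e(2) that] subsetD[OF e(3) that] by simp
    then have "e \<subseteq> {Suc k}" by blast
    moreover have "card e = 2" using t(1) e(1) by (simp add: simple_graph_def)
    ultimately show False using card_mono[of "{Suc k}" e] by simp
  qed
  have fin: "finite F" "finite G"
    using simple_graph_finite_edges[OF t(1)] by (auto simp: F_def G_def)
  have sF: "simple_graph {2..Suc k} F" and sG: "simple_graph {Suc k..M} G"
    using t(1) by (auto simp: F_def G_def simple_graph_def)
  \<comment> \<open>Retract everything outside the interval to \<open>Suc k\<close>: the root edge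
    and all edges of \<open>G\<close> collapse to this point. The same retraction serves for
    \<open>G\<close>.\<close>
  have "connected_graph {2..Suc k} F"
  proof (rule connected_graph_map[OF t(2), of _ "\<lambda>v. if v \<in> {2..Suc k} then v else Suc k"])
    show "{2..Suc k} \<subseteq> (\<lambda>v. if v \<in> {2..Suc k} then v else Suc k) ` {1..M}"
      using k by (force simp: image_iff)
    fix u v assume "{u, v} \<in> E"
    let ?f = "\<lambda>v. if v \<in> {2..Suc k} then v else Suc k"
    from cases[OF \<open>{u, v} \<in> E\<close>] consider "{u, v} \<in> F" | "{u, v} = {1, Suc k}" | "{u, v} \<in> G"
      by blast
    then show "(?f u, ?f v) \<in> reach F"
    proof cases
      case 1
      then have "?f u = u" "?f v = v" by (auto simp: F_def)
      then show ?thesis using reach_edge[OF 1] by simp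
    next
      case 2
      then have "?f u = Suc k" "?f v = Suc k" using k by (auto simp: doubleton_eq_iff)
      then show ?thesis by simp
    next
      case 3
      then have "?f u = Suc k" "?f v = Suc k" by (auto simp: G_def)
      then show ?thesis by simp
    qed
  qed (use k in auto)
  moreover have "connected_graph {Suc k..M} G"
  proof (rule connected_graph_map[OF t(2), of _ "\<lambda>v. if v \<in> {Suc k..M} then v else Suc k"])
    show "{Suc k..M} \<subseteq> (\<lambda>v. if v \<in> {Suc k..M} then v else Suc k) ` {1..M}"
      using k by (force simp: image_iff)
    fix u v assume "{u, v} \<in> E"
    let ?f = "\<lambda>v. if v \<in> {Suc k..M} then v else Suc k"
    from cases[OF \<open>{u, v} \<in> E\<close>] consider "{u, v} \<in> G" | "{u, v} = {1, Suc k}" | "{u, v} \<in> F"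
      by blast
    then show "(?f u, ?f v) \<in> reach G"
    proof cases
      case 1
      then have "?f u = u" "?f v = v" by (auto simp: G_def)
      then show ?thesis using reach_edge[OF 1] by simp
    next
      case 2
      then have "?f u = Suc k" "?f v = Suc k" using k by (auto simp: doubleton_eq_iff)
      then show ?thesis by simp
    next
      case 3
      then have "?f u = Suc k" "?f v = Suc k" by (auto simp: F_def)
      then show ?thesis by simp
    qed
  qed (use k in auto)
  \<comment> \<open>The root is lost and \<open>Suc k\<close> is counted twice, so the vertices
    still add up to \<open>M\<close>; only the root edge is missing from the edges.\<close>
  moreover have "card {2..Suc k} + card {Suc k..M} = card F + card G + 2"
  proof -
    have "card E = Suc (card F + card G)"
      using notin FG fin unfolding E_eq by (simp add: card_Un_disjoint)
    then show ?thesis using t(3) k by simp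
  qed
  ultimately have "edge_tree {2..Suc k} F" "edge_tree {Suc k..M} G"
    using edge_tree_pair sF sG by blast+
  moreover have "crossing_free F" "crossing_free G"
    using crossing_free_mono[OF cf] by (auto simp: F_def G_def)
  ultimately show ?thesis using E_eq by (auto simp: nc_trees_def)
qed

lemma reach_restrict:
  assumes "(x, y) \<in> reach E" "x \<in> S" "\<And>u v. {u, v} \<in> E \<Longrightarrow> u \<in> S \<Longrightarrow> v \<in> S"
  shows "(x, y) \<in> reach (E \<inter> Pow S)" "y \<in> S"
proof -
  have "(x, y) \<in> reach (E \<inter> Pow S) \<and> y \<in> S"
    using assms(1)
  proof induction
    case (step y z)
    then have "z \<in> S" using assms(3)[of y z] by simp
    then have "(y, z) \<in> {(x, y). {x, y} \<in> E \<inter> Pow S}" using step by simp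
    then show ?case using step.IH \<open>z \<in> S\<close> by (blast intro: rtrancl_into_rtrancl)
  qed (use assms(2) in simp)
  then show "(x, y) \<in> reach (E \<inter> Pow S)" "y \<in> S" by auto
qed

text \<open>The cut \<open>k\<close> is the largest vertex of the component of 1 after the edge
  \<open>{1, M}\<close> is deleted. Planarity makes this component an initial interval, and
  everything else is joined to \<open>M\<close>.\<close>

lemma split_at_last:
  assumes E: "E \<in> nc_trees {1..M}" and last: "{1, M} \<in> E"
  shows "\<exists>k\<in>{1..<M}. \<exists>F\<in>nc_trees {1..k}. \<exists>G\<in>nc_trees {Suc k..M}. E = insert {1, M} (F \<union> G)"
proof -
  have t: "simple_graph {1..M} E" "connected_graph {1..M} E" "card {1..M} = Suc (card E)"
    and cf: "crossing_free E" using E by (auto simp: nc_trees_def edge_tree_def)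
  have M: "1 < M" using simple_graph_edge[OF t(1) last] by auto
  define E0 where "E0 = E - {{1, M}}"
  have finE: "finite E" using t(1) by (rule simple_graph_finite_edges)
  have cE0: "card E = Suc (card E0)"
    unfolding E0_def using last finE by (metis card_Suc_Diff1)
  have edge0: "{u, v} \<in> E0 \<or> u = 1 \<and> v = M \<or> u = M \<and> v = 1" if "{u, v} \<in> E" for u v
    using that by (auto simp: E0_def doubleton_eq_iff)
  \<comment> \<open>If 1 still reached \<open>M\<close>, the remaining graph would be connected with
    one edge too few.\<close>
  have not_reach: "(1, M) \<notin> reach E0"
  proof
    assume *: "(1, M) \<in> reach E0"
    have "connected_graph {1..M} E0"
    proof (rule connected_graph_map[OF t(2), of _ "\<lambda>x. x"])
      fix u v assume "{u, v} \<in> E"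
      then show "(u, v) \<in> reach E0" using edge0[of u v] * reach_sym[OF *] by auto
    qed (use M in auto)
    then have "card {1..M} \<le> Suc (card E0)"
      by (rule connected_graph_card_le[rotated]) (use finE in \<open>simp add: E0_def\<close>)
    then show False using t(3) cE0 by simp
  qed
  \<comment> \<open>Follow a path from 1 in \<open>E\<close>; each use of the deleted edge restarts
    it at 1 or at \<open>M\<close>.\<close>
  have reach_or: "(1, v) \<in> reach E0 \<or> (M, v) \<in> reach E0" if "v \<in> {1..M}" for v
  proof -
    have "(1, v) \<in> reach E" using t(2) that M by (simp add: connected_graph_def)
    then show ?thesis
    proof induction
      case (step y z)
      then have "{y, z} \<in> E" by simp
      from edge0[OF this] show ?case
      proof (elim disjE conjE)
        assume "{y, z} \<in> E0"
        then have "(y, z) \<in> reach E0" by (rule reach_edge)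
        from rtrancl_trans[OF _ this] show ?case using step.IH by blast
      qed auto
    qed simp
  qed
  define C where "C = {v \<in> {1..M}. (1, v) \<in> reach E0}"
  have C1: "1 \<in> C" "finite C" using M by (auto simp: C_def)
  have C_step: "v \<in> C" if "{u, v} \<in> E0" "u \<in> C" for u v
  proof -
    have "(1, v) \<in> reach E0" using that by (auto simp: C_def intro: rtrancl_into_rtrancl)
    moreover have "v \<in> {1..M}" using that(1) simple_graph_edge[OF t(1), of u v] by (simp add: E0_def)
    ultimately show ?thesis by (simp add: C_def)
  qed
  define k where "k = Max C"
  have k: "k \<in> C" "\<And>v. v \<in> C \<Longrightarrow> v \<le> k" 
  proof -
    have "C \<noteq> {}" using C1(1) by blast
    then show "k \<in> C" using C1(2) unfolding k_def by (rule Max_in[rotated])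
    show "v \<le> k" if "v \<in> C" for v using C1(2) that unfolding k_def by (rule Max_ge)
  qed
  have kM: "k \<in> {1..<M}"
    using k(1) not_reach by (auto simp: C_def le_less)
  \<comment> \<open>A gap \<open>x\<close> in the component of 1 lies below some edge \<open>{u, v}\<close> of that component, which the
    path from \<open>x\<close> to \<open>M\<close> would have to cross.\<close>
  have C_eq: "C = {1..k}"
  proof (intro equalityI subsetI)
    fix x assume x: "x \<in> {1..k}"
    show "x \<in> C"
    proof (rule ccontr)
      assume "x \<notin> C"
      then have x1: "1 < x" "x < k" using x C1(1) k(1) by (auto simp: le_less)
      have "(1, k) \<in> reach E0" using k(1) by (simp add: C_def)
      then obtain u v where uv: "{u, v} \<in> E0" "u < x" "\<not> v < x" "(1, u) \<in> reach E0"
        using reach_leaves[of 1 k E0 "{..<x}"] x1 by auto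
      have uC: "u \<in> C" using uv(1,4) simple_graph_edge[OF t(1), of u v] by (simp add: C_def E0_def)
      moreover have "v \<in> C" using C_step[OF uv(1) uC] .
      moreover have "v \<noteq> x" using \<open>v \<in> C\<close> \<open>x \<notin> C\<close> by blast
      ultimately have v: "x < v" "v < M" "u \<in> C" "v \<in> C" using uv(3) k(2)[of v] kM by auto
      have "(M, x) \<in> reach E0" using reach_or[of x] x kM \<open>x \<notin> C\<close> by (auto simp: C_def)
      then have "(x, M) \<in> reach E0" by (rule reach_sym)
      then obtain p q where pq: "{p, q} \<in> E0" "p \<in> {u<..<v}" "q \<notin> {u<..<v}" "(x, p) \<in> reach E0"
        using reach_leaves[of x M E0 "{u<..<v}"] uv(2) v by auto
      have "p \<notin> C"
      proof
        assume "p \<in> C"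
        then have "(1, x) \<in> reach E0" using reach_sym[OF pq(4)] by (auto simp: C_def)
        then show False using \<open>x \<notin> C\<close> x kM by (simp add: C_def)
      qed
      moreover have "{q, p} \<in> E0" using pq(1) by (simp add: insert_commute)
      ultimately have "q \<notin> C" using C_step by blast
      \<comment> \<open>Not sharing an end with \<open>{u, v}\<close>, the edge
        \<open>{p, q}\<close> leads strictly outside the interval and really crosses.\<close>
      then have "q \<noteq> u" "q \<noteq> v" using v by auto
      then have "q < u \<or> v < q" using pq(3) by auto
      moreover have "{u, v} \<in> E" "{p, q} \<in> E" "{q, p} \<in> E"
        using uv(1) pq(1) \<open>{q, p} \<in> E0\<close> by (auto simp: E0_def)
      ultimately show False using cf pq(2) unfolding crossing_free_def
        by (metis greaterThanLessThan_iff)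
    qed
  qed (use k in \<open>auto simp: C_def\<close>)
  define F where "F = E0 \<inter> Pow {1..k}"
  define G where "G = E0 \<inter> Pow {Suc k..M}"
  have inV: "u \<in> {1..M}" "v \<in> {1..M}" if "{u, v} \<in> E0" for u v
    using that simple_graph_edge[OF t(1), of u v] by (auto simp: E0_def)
  have closedF: "v \<in> {1..k}" if "{u, v} \<in> E0" "u \<in> {1..k}" for u v
    using C_step that unfolding C_eq .
  have closedG: "v \<in> {Suc k..M}" if "{u, v} \<in> E0" "u \<in> {Suc k..M}" for u v
    using closedF[of v u] inV[of u v] that
    by (cases "v \<le> k") (auto simp: insert_commute)
  have E0_eq: "E0 = F \<union> G"
  proof (intro equalityI subsetI)
    fix e assume e: "e \<in> E0"
    then have "e \<in> E" by (simp add: E0_def)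
    then obtain a b where ab: "e = {a, b}" using simple_graph_edgeE[OF t(1)] by metis
    have "a \<in> {1..k} \<or> a \<in> {Suc k..M}" using ab inV[of a b] e by auto
    then show "e \<in> F \<union> G"
      using closedF[of a b] closedG[of a b] e ab by (auto simp: F_def G_def)
  qed (auto simp: F_def G_def)
  have "connected_graph {1..k} F"
  proof (rule connected_graph_from)
    show "1 \<in> {1..k}" using kM by simp
    fix v assume "v \<in> {1..k}"
    then have "(1, v) \<in> reach E0" unfolding C_eq[symmetric] by (simp add: C_def)
    then show "(1, v) \<in> reach F"
      unfolding F_def by (rule reach_restrict) (use kM closedF in auto)
  qed
  moreover have "connected_graph {Suc k..M} G"
  proof (rule connected_graph_from)
    show "M \<in> {Suc k..M}" using kM by simp
    fix v assume v: "v \<in> {Suc k..M}"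
    then have "v \<notin> C" unfolding C_eq by simp
    then have "(M, v) \<in> reach E0" using reach_or[of v] v by (auto simp: C_def)
    then show "(M, v) \<in> reach G"
      unfolding G_def by (rule reach_restrict) (use kM closedG in auto)
  qed
  moreover have "simple_graph {1..k} F" "simple_graph {Suc k..M} G"
    using t(1) by (auto simp: F_def G_def E0_def simple_graph_def)
  moreover have "card {1..k} + card {Suc k..M} = card F + card G + 2"
  proof -
    have "finite F" "finite G" using finE by (auto simp: F_def G_def E0_def)
    moreover have "F \<inter> G = {}"
    proof (rule ccontr)
      assume "F \<inter> G \<noteq> {}"
      then obtain e where e: "e \<in> E" "e \<subseteq> {1..k}" "e \<subseteq> {Suc k..M}"
        unfolding F_def G_def E0_def by blast
      have False if "x \<in> e" for x using subsetD[OF e(2) that] subsetD[OF e(3) that] by simp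
      then have "e = {}" by blast
      with e(1)
      show False using t(1) by (auto simp: simple_graph_def)
    qed
    ultimately have "card E0 = card F + card G" unfolding E0_eq by (rule card_Un_disjoint)
    then show ?thesis using t(3) cE0 kM by simp
  qed
  ultimately have "edge_tree {1..k} F" "edge_tree {Suc k..M} G"
    using edge_tree_pair by blast+
  moreover have "crossing_free F" "crossing_free G"
    by (auto simp: F_def G_def E0_def intro!: crossing_free_mono[OF cf])
  moreover have "E = insert {1, M} (F \<union> G)"
    unfolding E0_eq[symmetric] using last by (auto simp: E0_def)
  ultimately have "F \<in> nc_trees {1..k}" "G \<in> nc_trees {Suc k..M}" "E = insert {1, M} (F \<union> G)"
    by (simp_all add: nc_trees_def)
  then show ?thesis using kM by blast
qed

section \<open>Two families of trees with the same convolution count\<close>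

lemma card_nc_trees_last_edge:
  "card {E \<in> nc_trees {1..M}. {1, M} \<in> E} = (\<Sum>k\<in>{1..<M}. num_nct k * num_nct (M - k))"
proof -
  have "card {E \<in> nc_trees {1..M}. {1, M} \<in> E} =
    (\<Sum>k\<in>{1..<M}. card (nc_trees {1..k}) * card (nc_trees {Suc k..M}))"
  proof (rule card_glued_trees[where e = "\<lambda>k. {1, M}"])
    fix k l F G F' G'
    assume *: "k \<in> {1..<M}" "l \<in> {1..<M}" "F \<in> nc_trees {1..k}" "G \<in> nc_trees {Suc k..M}"
      "F' \<in> nc_trees {1..l}" "G' \<in> nc_trees {Suc l..M}"
      "insert {1, M} (F \<union> G) = insert {1, M} (F' \<union> G')"
    show "k \<le> l"
    proof (rule ccontr)
      assume "\<not> k \<le> l"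
      \<comment> \<open>The path in \<open>F\<close> from 1 to \<open>k\<close> must pass from
        labels up to \<open>l\<close> to larger ones. Its edge doing so is not
        \<open>{1, M}\<close>, since \<open>F\<close> avoids \<open>M\<close>, and it fits into
        neither \<open>F'\<close> nor \<open>G'\<close>.\<close>
      then have "(1, k) \<in> reach F"
        using *(1,3) by (simp add: nc_trees_def edge_tree_def connected_graph_def)
      then obtain u v where uv: "{u, v} \<in> F" "u \<le> l" "\<not> v \<le> l" "(1, u) \<in> reach F"
        using reach_leaves[of 1 k F "{..l}"] *(2) \<open>\<not> k \<le> l\<close> by auto
      then have "v < M" "u < M" using nc_trees_edge[OF *(3) uv(1)] *(1) by auto
      moreover have "{u, v} \<in> insert {1, M} (F' \<union> G')" unfolding *(7)[symmetric] using uv(1) by simp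
      ultimately have "{u, v} \<in> F' \<or> {u, v} \<in> G'" by (auto simp: doubleton_eq_iff)
      then show False
        using nc_trees_edge[OF *(5), of u v] nc_trees_edge[OF *(6), of u v] uv by auto
    qed
  next
    show "{E \<in> nc_trees {1..M}. {1, M} \<in> E} =
      (\<Union>k\<in>{1..<M}. \<Union>F\<in>nc_trees {1..k}. \<Union>G\<in>nc_trees {Suc k..M}. {insert {1, M} (F \<union> G)})"
      using glue_at_last[of _ M] split_at_last[of _ M] by fastforce
  qed auto
  also have "\<dots> = (\<Sum>k\<in>{1..<M}. num_nct k * num_nct (M - k))"
    by (intro sum.cong) (simp_all add: card_nc_trees_atLeastAtMost)
  finally show ?thesis .
qed

text \<open>The neighbour \<open>Suc k\<close> of the root determines the decomposition. The pieces
  share this vertex, but \<open>{2..Suc k}\<close> has k labels and \<open>{Suc k..M}\<close> has M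
  - k, so the summands agree with those for trees containing \<open>{1, M}\<close>.\<close>

lemma num_nct_root1_eq:
  assumes "1 < M"
  shows "num_nct_root1 M = (\<Sum>k\<in>{1..<M}. num_nct k * num_nct (M - k))"
proof -
  have "card {E \<in> nc_trees {1..M}. degree_in E 1 = 1} =
    (\<Sum>k\<in>{1..<M}. card (nc_trees {2..Suc k}) * card (nc_trees {Suc k..M}))"
  proof (rule card_glued_trees[where e = "\<lambda>k. {1, Suc k}"])
    fix k l F G F' G'
    assume *: "k \<in> {1..<M}" "l \<in> {1..<M}" "F \<in> nc_trees {2..Suc k}" "G \<in> nc_trees {Suc k..M}"
      "F' \<in> nc_trees {2..Suc l}" "G' \<in> nc_trees {Suc l..M}"
      "insert {1, Suc k} (F \<union> G) = insert {1, Suc l} (F' \<union> G')"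
    have "{1, Suc k} \<notin> F'" "{1, Suc k} \<notin> G'"
      using nc_trees_edge(1)[OF *(5), of 1 "Suc k"] nc_trees_edge(1)[OF *(6), of 1 "Suc k"] *(2) by auto
    then have "{1, Suc k} = {1, Suc l}" using *(7) by blast
    then show "k \<le> l" by (auto simp: doubleton_eq_iff)
  next
    fix k assume "k \<in> {1..<M}"
    then have "{2..Suc k} \<inter> {Suc k..M} = {Suc k}" by auto
    then show "card ({2..Suc k} \<inter> {Suc k..M}) \<le> 1" by simp
  next
    show "{E \<in> nc_trees {1..M}. degree_in E 1 = 1} =
      (\<Union>k\<in>{1..<M}. \<Union>F\<in>nc_trees {2..Suc k}. \<Union>G\<in>nc_trees {Suc k..M}. {insert {1, Suc k} (F \<union> G)})"
    proof (intro equalityI subsetI)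
      fix E assume "E \<in> {E \<in> nc_trees {1..M}. degree_in E 1 = 1}"
      then have E: "E \<in> nc_trees {1..M}" "card {e \<in> E. 1 \<in> e} = 1" by (auto simp: degree_in_def)
      then obtain e where e: "{e \<in> E. 1 \<in> e} = {e}" by (meson card_1_singletonE)
      then have "e \<in> E" "1 \<in> e" by auto
      moreover have "simple_graph {1..M} E" using E(1) unfolding nc_trees_def edge_tree_def by blast
      ultimately obtain a b where "e = {a, b}" "a \<noteq> b" "a \<in> {1..M}" "b \<in> {1..M}"
        using simple_graph_edgeE by metis
      with \<open>1 \<in> e\<close> obtain j where j: "e = {1, j}" "1 < j" "j \<le> M"
        by (metis One_nat_def Suc_le_lessD atLeastAtMost_iff insertE insert_commute le_neq_implies_less singletonD)
      then have "Suc (j - 1) = j" "j - 1 \<in> {1..<M}" by auto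
      moreover from this have "{e \<in> E. 1 \<in> e} = {{1, Suc (j - 1)}}" using e j(1) by (simp only:)
      ultimately obtain F G where "F \<in> nc_trees {2..Suc (j - 1)}" "G \<in> nc_trees {Suc (j - 1)..M}"
        "E = insert {1, Suc (j - 1)} (F \<union> G)"
        using split_at_root[OF E(1)] by blast
      then show "E \<in> (\<Union>k\<in>{1..<M}. \<Union>F\<in>nc_trees {2..Suc k}. \<Union>G\<in>nc_trees {Suc k..M}.
          {insert {1, Suc k} (F \<union> G)})"
        using \<open>j - 1 \<in> {1..<M}\<close> by blast
    next
      fix E assume "E \<in> (\<Union>k\<in>{1..<M}. \<Union>F\<in>nc_trees {2..Suc k}. \<Union>G\<in>nc_trees {Suc k..M}.
          {insert {1, Suc k} (F \<union> G)})"
      then obtain k F G where k: "k \<in> {1..<M}" and F: "F \<in> nc_trees {2..Suc k}"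
        and G: "G \<in> nc_trees {Suc k..M}" and E: "E = insert {1, Suc k} (F \<union> G)" by blast
      have "1 \<notin> e" if "e \<in> F \<union> G" for e
        using that nc_trees_subset F G k by fastforce
      then have "{e \<in> E. 1 \<in> e} = {{1, Suc k}}" unfolding E by blast
      then show "E \<in> {E \<in> nc_trees {1..M}. degree_in E 1 = 1}"
        using glue_at_root[OF k F G] E by (simp add: degree_in_def)
    qed
  qed auto
  also have "\<dots> = (\<Sum>k\<in>{1..<M}. num_nct k * num_nct (M - k))"
    by (intro sum.cong) (simp_all add: card_nc_trees_atLeastAtMost)
  finally show ?thesis by (simp add: num_nct_root1_def noncrossing_trees_eq)
qed

section \<open>Rotations\<close>

lemma card_mod_shift:
  assumes "0 < (N::nat)" "\<And>i. i \<in> A \<Longrightarrow> (i + c) mod N \<in> B" "A \<subseteq> {..<N}" "finite B"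
  shows "card A \<le> card B"
proof (rule card_inj_on_le)
  show "inj_on (\<lambda>i. (i + c) mod N) A"
  proof (rule inj_on_inverseI)
    fix i assume "i \<in> A"
    \<comment> \<open>In the natural numbers \<open>N * c - c\<close> stands for minus c modulo N;
      the inequality keeps the subtraction from truncating.\<close>
    have "c \<le> N * c" using assms(1) by simp
    then have "((i + c) mod N + (N * c - c)) mod N = (i + N * c) mod N"
      unfolding mod_add_left_eq by simp
    then show "((i + c) mod N + (N * c - c)) mod N = i" using \<open>i \<in> A\<close> assms(3) by (simp add: subset_iff)
  qed
qed (use assms in auto)

text \<open>The action is by natural numbers with period N, which fits the definition of
  \<open>rot_orbit\<close>. Within an orbit the stabilizer of y has as many elements as the set of i
  carrying a fixed x to y, and these sets partition \<open>{..<N}\<close>. The lemma serves both for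
  trees and for the edges of one tree.\<close>

lemma burnside_cyclic:
  fixes act :: "nat \<Rightarrow> 'a \<Rightarrow> 'a"
  assumes fin: "finite X" and N: "0 < N"
    and closed: "\<And>i x. x \<in> X \<Longrightarrow> act i x \<in> X"
    and add: "\<And>i j x. x \<in> X \<Longrightarrow> act (i + j) x = act i (act j x)"
    and period: "\<And>x. x \<in> X \<Longrightarrow> act N x = x"
  shows "(\<Sum>x\<in>X. card {i \<in> {..<N}. act i x = x}) = N * card ((\<lambda>x. {act i x | i. True}) ` X)"
proof -
  define orb where "orb x = {act i x | i. True}" for x
  \<comment> \<open>The identity law follows from the period: x equals \<open>act (N + 0) x\<close>,
    which is \<open>act N\<close> applied to \<open>act 0 x\<close>.\<close>
  have zero: "act 0 x = x" if "x \<in> X" for x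
    using add[OF that, of N 0] period[OF closed[OF that, of 0]] period[OF that] by simp
  have mult: "act (N * q) x = x" if "x \<in> X" for q x
    using that by (induction q) (simp_all add: zero add period)
  have act_mod: "act (i mod N) x = act i x" if "x \<in> X" for i x
  proof -
    have "act i x = act (i mod N + N * (i div N)) x" by simp
    also have "\<dots> = act (i mod N) x" unfolding add[OF that] mult[OF that] ..
    finally show ?thesis ..
  qed
  have undo: "act (N * s - s) (act s x) = x" if "x \<in> X" for s x
  proof -
    have "s \<le> N * s" using N by simp
    then have "act (N * s - s) (act s x) = act (N * s) x" using add[OF that, of "N * s - s" s] by simp
    then show ?thesis using mult[OF that] by simp
  qed
  have orb_eq: "orb (act s x) = orb x" if x: "x \<in> X" for s x
  proof -
    have "act i (act s x) \<in> orb x" for i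
      unfolding orb_def add[OF x, symmetric] by blast
    moreover have "act i x \<in> orb (act s x)" for i
    proof -
      have "act i x = act i (act (N * s - s) (act s x))" using undo[OF x] by simp
      also have "\<dots> = act (i + (N * s - s)) (act s x)" using add[OF closed[OF x]] by simp
      finally show ?thesis unfolding orb_def by blast
    qed
    ultimately show ?thesis unfolding orb_def by blast
  qed
  \<comment> \<open>Adding \<open>s\<close> turns a stabilizing index of y into one carrying x to y;
    adding the inverse shift goes back.\<close>
  have stab: "card {i \<in> {..<N}. act i y = y} = card {i \<in> {..<N}. act i x = y}"
    if x: "x \<in> X" and y: "y = act s x" for x y s
  proof (rule antisym)
    have yX: "y \<in> X" using closed x y by simp
    show "card {i \<in> {..<N}. act i y = y} \<le> card {i \<in> {..<N}. act i x = y}"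
    proof (rule card_mod_shift[OF N, where c = s])
      fix i assume "i \<in> {i \<in> {..<N}. act i y = y}"
      then show "(i + s) mod N \<in> {i \<in> {..<N}. act i x = y}"
        using act_mod[OF x, of "i + s"] add[OF x, of i s] y N by simp
    qed auto
    show "card {i \<in> {..<N}. act i x = y} \<le> card {i \<in> {..<N}. act i y = y}"
    proof (rule card_mod_shift[OF N, where c = "N * s - s"])
      fix i assume i: "i \<in> {i \<in> {..<N}. act i x = y}"
      have "act ((i + (N * s - s)) mod N) y = act i x"
        using act_mod[OF yX] add[OF yX, of i] undo[OF x, of s] y by simp
      then show "(i + (N * s - s)) mod N \<in> {i \<in> {..<N}. act i y = y}" using i N by simp
    qed auto
  qed
  have fiber: "(\<Sum>x \<in> {x \<in> X. orb x = P}. card {i \<in> {..<N}. act i x = x}) = N" if P: "P \<in> orb ` X" for P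
  proof -
    obtain x where x: "x \<in> X" "P = orb x" using P by blast
    have "{y \<in> X. orb y = P} = orb x"
    proof (intro equalityI subsetI)
      fix y assume "y \<in> {y \<in> X. orb y = P}"
      then have "y \<in> X" "orb y = orb x" using x by auto
      moreover from this have "y \<in> orb y" unfolding orb_def using zero[of y] by (metis (mono_tags, lifting) mem_Collect_eq)
      ultimately show "y \<in> orb x" by simp
    next
      fix y assume "y \<in> orb x"
      then obtain s where "y = act s x" unfolding orb_def by blast
      then show "y \<in> {y \<in> X. orb y = P}" using closed[OF x(1)] orb_eq[OF x(1)] x by simp
    qed
    moreover have "(\<Sum>y \<in> orb x. card {i \<in> {..<N}. act i y = y}) =
        (\<Sum>y \<in> orb x. card {i \<in> {..<N}. act i x = y})"
    proof (rule sum.cong)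
      fix y assume "y \<in> orb x"
      then obtain s where "y = act s x" unfolding orb_def by blast
      with x(1) show "card {i \<in> {..<N}. act i y = y} = card {i \<in> {..<N}. act i x = y}" by (rule stab)
    qed simp
    moreover have "(\<Sum>y \<in> orb x. card {i \<in> {..<N}. act i x = y}) = N"
    proof -
      have "orb x \<subseteq> X" using closed[OF x(1)] unfolding orb_def by blast
      then have "finite (orb x)" using fin by (rule finite_subset)
      moreover have "(\<lambda>i. act i x) ` {..<N} \<subseteq> orb x" unfolding orb_def by blast
      ultimately have "(\<Sum>y \<in> orb x. \<Sum>i \<in> {i. i \<in> {..<N} \<and> act i x = y}. 1) = (\<Sum>i<N. 1::nat)"
        by (intro sum.group) auto
      then show ?thesis by simp
    qed
    ultimately show ?thesis by simp
  qed
  have "(\<Sum>x\<in>X. card {i \<in> {..<N}. act i x = x}) =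
      (\<Sum>P \<in> orb ` X. \<Sum>x \<in> {x \<in> X. orb x = P}. card {i \<in> {..<N}. act i x = x})"
    by (rule sum.image_gen[OF fin])
  also have "\<dots> = (\<Sum>P \<in> orb ` X. N)" using fiber by (intro sum.cong) auto
  finally show ?thesis by (simp add: orb_def mult.commute)
qed

section \<open>Rotation of labels, edges and trees\<close>

lemma rot_vertex_in: "0 < n \<Longrightarrow> rot_vertex n k j \<in> {1..n}"
  by (simp add: rot_vertex_def Suc_le_eq)

lemma rot_vertex_add:
  assumes "1 \<le> j"
  shows "rot_vertex n (k + l) j = rot_vertex n k (rot_vertex n l j)"
proof -
  have "(j + l - 1) mod n + 1 + k - 1 = (j + l - 1) mod n + k" by simp
  moreover have "j + (k + l) - 1 = (j + l - 1) + k" using assms by simp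
  ultimately show ?thesis unfolding rot_vertex_def by (simp only: mod_add_left_eq)
qed

text \<open>Translations act freely on the labels: a rotation with one fixed label is
  trivial.\<close>

lemma rot_vertex_eq_self_iff:
  assumes "j \<in> {1..n}"
  shows "rot_vertex n k j = j \<longleftrightarrow> n dvd k"
proof -
  have "rot_vertex n k j = j \<longleftrightarrow> (j - 1 + k) mod n = (j - 1) mod n"
    using assms by (auto simp: rot_vertex_def)
  also have "\<dots> \<longleftrightarrow> n dvd k" by (simp add: mod_eq_dvd_iff_nat)
  finally show ?thesis .
qed

lemma inj_on_rot_vertex: "inj_on (rot_vertex n k) {1..n}"
proof (rule inj_on_inverseI)
  fix j assume j: "j \<in> {1..n}"
  then have "k \<le> n * k" by simp
  then have "rot_vertex n (n * k - k) (rot_vertex n k j) = rot_vertex n (n * k) j"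
    using rot_vertex_add[of j n "n * k - k" k] j by simp
  also have "\<dots> = j" using rot_vertex_eq_self_iff[OF j] by simp
  finally show "rot_vertex n (n * k - k) (rot_vertex n k j) = j" .
qed

lemma rot_vertex_image: "rot_vertex n k ` {1..n} = {1..n}"
proof (cases "n = 0")
  case False
  then show ?thesis
    using endo_inj_surj[OF _ _ inj_on_rot_vertex] rot_vertex_in by (simp add: image_subset_iff)
qed simp

lemma rot_edge_add:
  assumes "e \<subseteq> {1..n}"
  shows "rot_vertex n (k + l) ` e = rot_vertex n k ` rot_vertex n l ` e"
  unfolding image_image using assms by (intro image_cong) (auto simp: rot_vertex_add)

lemma rot_edge_period:
  assumes "e \<subseteq> {1..n}" "n dvd k"
  shows "rot_vertex n k ` e = e"
proof -
  have "rot_vertex n k ` e = (\<lambda>x. x) ` e"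
    using assms by (intro image_cong) (auto simp: rot_vertex_eq_self_iff)
  then show ?thesis by simp
qed

lemma rot_tree_add:
  assumes "E \<subseteq> Pow {1..n}"
  shows "rot_tree n (k + l) E = rot_tree n k (rot_tree n l E)"
  unfolding rot_tree_def image_image[of "\<lambda>e. rot_vertex n k ` e"]
  using assms by (intro image_cong refl rot_edge_add) auto

lemma rot_tree_period:
  assumes "E \<subseteq> Pow {1..n}" "n dvd k"
  shows "rot_tree n k E = E"
proof -
  have "rot_tree n k E = (\<lambda>e. e) ` E"
    unfolding rot_tree_def using assms by (intro image_cong refl rot_edge_period) auto
  then show ?thesis by simp
qed

lemma rot_edge_in_rot_tree: "{a, b} \<in> E \<Longrightarrow> {rot_vertex n k a, rot_vertex n k b} \<in> rot_tree n k E"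
  unfolding rot_tree_def by (rule image_eqI[of _ _ "{a, b}"]) auto

lemma rot_tree_edgeE:
  assumes "{a, b} \<in> rot_tree n k E" "simple_graph {1..n} E"
  obtains u v where "{u, v} \<in> E" "u \<in> {1..n}" "v \<in> {1..n}"
    "a = rot_vertex n k u" "b = rot_vertex n k v"
proof -
  obtain e where e: "e \<in> E" "{a, b} = rot_vertex n k ` e" using assms(1) by (auto simp: rot_tree_def)
  obtain u v where uv: "e = {u, v}" "u \<in> {1..n}" "v \<in> {1..n}"
    using simple_graph_edgeE[OF assms(2) e(1)] by metis
  then have "a = rot_vertex n k u \<and> b = rot_vertex n k v \<or> a = rot_vertex n k v \<and> b = rot_vertex n k u"
    using e(2) by (simp add: doubleton_eq_iff)
  moreover have "{u, v} \<in> E" "{v, u} \<in> E" using e(1) uv(1) by (simp_all add: insert_commute)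
  ultimately show ?thesis using that uv(2,3) by blast
qed

text \<open>Reduction modulo n discards whole turns, which \<open>cis\<close> does not see.\<close>

lemma vertex_point_rot:
  assumes "1 \<le> j" "0 < n"
  shows "vertex_point n (rot_vertex n k j) = cis (2 * pi * real k / real n) * vertex_point n j"
proof -
  let ?x = "j + k - 1"
  have "real (?x mod n) = real ?x - real n * real (?x div n)"
    by (metis add_diff_cancel_left' div_mult_mod_eq mult.commute of_nat_add of_nat_mult)
  also have "real ?x = real j + real k - 1" using assms by (simp add: of_nat_diff)
  finally have "(real (?x mod n + 1) - 1) * (2 * pi) / real n =
      (real j + real k - 1 - real n * real (?x div n)) * (2 * pi) / real n" by simp
  also have "\<dots> = (2 * pi * real k / real n + (real j - 1) * (2 * pi) / real n)
      - 2 * pi * real (?x div n)"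
    using assms by (simp add: field_simps)
  finally have "(real (?x mod n + 1) - 1) * (2 * pi) / real n =
      (2 * pi * real k / real n + (real j - 1) * (2 * pi) / real n) - 2 * pi * real (?x div n)" .
  then show ?thesis
    unfolding vertex_point_def rot_vertex_def by (simp add: cis_mult flip: cis_divide)
qed

text \<open>Wrap-around destroys the linear order, so the proof passes through the chords:
  multiplication by a unit complex number is linear and injective and maps open segments to open
  segments.\<close>

lemma crossing_free_rot_tree:
  assumes "simple_graph {1..n} E" "crossing_free E"
  shows "simple_graph {1..n} (rot_tree n k E)" "crossing_free (rot_tree n k E)"
proof -
  have im: "rot_vertex n k ` e \<subseteq> {1..n}" "card (rot_vertex n k ` e) = 2" if "e \<in> E" for e
  proof -
    have e: "e \<subseteq> {1..n}" "card e = 2" using that assms(1) by (auto simp: simple_graph_def)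
    then show "rot_vertex n k ` e \<subseteq> {1..n}" using rot_vertex_image by blast
    show "card (rot_vertex n k ` e) = 2"
      using card_image[OF inj_on_subset[OF inj_on_rot_vertex e(1)]] e(2) by simp
  qed
  then show simple: "simple_graph {1..n} (rot_tree n k E)"
    by (auto simp: simple_graph_def rot_tree_def)
  have nc: "noncrossing n E" using assms noncrossing_iff_crossing_free by blast
  have "noncrossing n (rot_tree n k E)"
    unfolding noncrossing_def
  proof (intro allI impI)
    fix a b c d
    assume ab: "{a, b} \<in> rot_tree n k E" and cd: "{c, d} \<in> rot_tree n k E" and ne: "{a, b} \<noteq> {c, d}"
    obtain p q where pq: "{p, q} \<in> E" "p \<in> {1..n}" "q \<in> {1..n}"
      "a = rot_vertex n k p" "b = rot_vertex n k q" using rot_tree_edgeE[OF ab assms(1)] .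
    obtain r s where rs: "{r, s} \<in> E" "r \<in> {1..n}" "s \<in> {1..n}"
      "c = rot_vertex n k r" "d = rot_vertex n k s" using rot_tree_edgeE[OF cd assms(1)] .
    let ?f = "(*) (cis (2 * pi * real k / real n))"
    have f: "linear ?f" "inj ?f" by (auto simp: linear_times inj_on_def)
    have vp: "vertex_point n (rot_vertex n k j) = ?f (vertex_point n j)" if "j \<in> {1..n}" for j
      using that by (intro vertex_point_rot) auto
    have "{p, q} \<noteq> {r, s}"
    proof
      assume "{p, q} = {r, s}"
      then have "rot_vertex n k ` {p, q} = rot_vertex n k ` {r, s}" by (rule arg_cong)
      then show False using ne pq rs by simp
    qed
    then have "open_segment (vertex_point n p) (vertex_point n q) \<inter>
        open_segment (vertex_point n r) (vertex_point n s) = {}"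
      using nc pq(1) rs(1) unfolding noncrossing_def by blast
    then have "?f ` open_segment (vertex_point n p) (vertex_point n q) \<inter>
        ?f ` open_segment (vertex_point n r) (vertex_point n s) = {}"
      using image_Int[OF f(2)] by (metis image_empty)
    then show "open_segment (vertex_point n a) (vertex_point n b) \<inter>
        open_segment (vertex_point n c) (vertex_point n d) = {}"
      unfolding pq(4,5) rs(4,5) vp[OF pq(2)] vp[OF pq(3)] vp[OF rs(2)] vp[OF rs(3)]
        open_segment_linear_image[OF f] .
  qed
  then show "crossing_free (rot_tree n k E)"
    using noncrossing_iff_crossing_free[OF simple] by blast
qed

lemma rot_tree_nc_trees:
  assumes "E \<in> nc_trees {1..n}"
  shows "rot_tree n k E \<in> nc_trees {1..n}"
proof -
  have E: "edge_tree {1..n} E" "crossing_free E" using assms by (auto simp: nc_trees_def)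
  have "edge_tree {1..n} (rot_tree n k E)"
    using edge_tree_image[OF E(1) inj_on_rot_vertex, of k]
    unfolding rot_vertex_image rot_tree_def .
  moreover have "crossing_free (rot_tree n k E)"
    using crossing_free_rot_tree(2)[of n E k] E unfolding edge_tree_def by blast
  ultimately show ?thesis by (simp add: nc_trees_def)
qed

section \<open>Rotationally symmetric trees\<close>

lemma rot_vertex_half:
  assumes "v \<in> {1..2 * m}"
  shows "rot_vertex (2 * m) m v = (if v \<le> m then v + m else v - m)"
proof (cases "v \<le> m")
  case True
  then have "v + m - 1 < 2 * m" using assms by auto
  then show ?thesis using True assms by (simp add: rot_vertex_def)
next
  case False
  then have "v + m - 1 = (v - m - 1) + 2 * m" using assms by auto
  then have "(v + m - 1) mod (2 * m) = (v - m - 1) mod (2 * m)" by simp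
  also have "\<dots> = v - m - 1" using assms False by (intro mod_less) auto
  finally show ?thesis using False by (simp add: rot_vertex_def)
qed

text \<open>Normal form of a diameter: its smaller end is \<open>1 + i\<close>, so the m diameters
  are indexed by i < m.\<close>

lemma diameter_form:
  assumes "a \<in> {1..2 * m}"
  obtains i where "i < m" "{a, rot_vertex (2 * m) m a} = {1 + i, 1 + i + m}"
proof (cases "a \<le> m")
  case True
  then show ?thesis
    using that[of "a - 1"] assms rot_vertex_half[OF assms] by auto
next
  case False
  then show ?thesis
    using that[of "a - m - 1"] assms rot_vertex_half[OF assms] by (auto simp: Suc_diff_Suc insert_commute)
qed

text \<open>For i < j < m the ends interleave as 1 + i < 1 + j < 1 + i + m < 1 + j + m.\<close>

lemma diameter_unique:
  assumes "crossing_free E" "{1 + i, 1 + i + m} \<in> E" "{1 + j, 1 + j + m} \<in> E" "i < m" "j < m"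
  shows "i = j"
proof -
  have "\<not> (1 + i < 1 + j \<and> 1 + j < 1 + i + m \<and> 1 + i + m < 1 + j + m)"
    "\<not> (1 + j < 1 + i \<and> 1 + i < 1 + j + m \<and> 1 + j + m < 1 + i + m)"
    using assms(1-3) unfolding crossing_free_def by blast+
  then show ?thesis using assms(4,5) by auto
qed

text \<open>If no diameter is an edge, then the group generated by the rotation acts freely on the edges,
  so its order divides both the number of edges and the number of vertices.\<close>

lemma rot_fixed_tree:
  assumes E: "E \<in> nc_trees {1..n}" and inv: "rot_tree n k E = E" and k: "0 < k" "k < n"
  shows "n = 2 * k" "\<exists>i<k. {1 + i, 1 + i + k} \<in> E"
proof -
  have t: "simple_graph {1..n} E" and card_E: "n = Suc (card E)" and cf: "crossing_free E"
    using E by (auto simp: nc_trees_def edge_tree_def)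
  have sub: "E \<subseteq> Pow {1..n}" using t by (auto simp: simple_graph_def)
  have subE: "e \<subseteq> {1..n}" if "e \<in> E" for e using sub that by blast
  \<comment> \<open>The quotient \<open>N\<close> of \<open>n\<close> by this gcd is the order of
    the rotation by \<open>k\<close>.\<close>
  define d where "d = gcd n k"
  have d: "0 < d" "d \<le> k" "d dvd n" "d dvd k" using k by (auto simp: d_def gcd_le2_nat)
  obtain N k' where N_eq: "n = N * d" and k_eq: "k = k' * d" and "coprime N k'"
    using gcd_coprime_exists[of n k] d(1) unfolding d_def by auto
  have N: "1 < N"
  proof (rule ccontr)
    assume "\<not> 1 < N"
    then have "n \<le> d" unfolding N_eq by (cases N) auto
    then show False using d(2) k by simp
  qed
  have dvd: "N dvd j" if "n dvd j * k" for j
  proof -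
    have "N * d dvd (j * k') * d" using that unfolding N_eq k_eq by (simp only: mult.assoc)
    then have "N dvd j * k'" using d(1) by simp
    then show ?thesis using \<open>coprime N k'\<close> by (simp add: coprime_dvd_mult_left_iff)
  qed
  define act where "act j e = rot_vertex n (j * k) ` e" for j e
  have closed: "act j e \<in> E" if "e \<in> E" for j e
  proof (induction j)
    case 0
    then show ?case using that rot_edge_period[OF subE[OF that], of 0] by (simp add: act_def)
  next
    case (Suc j)
    have "act (Suc j) e = rot_vertex n k ` act j e"
      unfolding act_def using rot_edge_add[OF subE[OF that], of k "j * k"] by simp
    then have "act (Suc j) e \<in> rot_tree n k E" using Suc unfolding rot_tree_def by simp
    then show ?case unfolding inv .
  qed
  have add: "act (i + j) e = act i (act j e)" if "e \<in> E" for i j e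
    unfolding act_def using rot_edge_add[OF subE[OF that], of "i * k" "j * k"]
    by (simp add: distrib_right)
  have "N * k = n * k'" unfolding N_eq k_eq by simp
  then have dvd_Nk: "n dvd N * k" by simp
  have period: "act N e = e" if "e \<in> E" for e
    using rot_edge_period[OF subE[OF that] dvd_Nk] unfolding act_def .
  have act0: "act 0 e = e" if "e \<in> E" for e
    using rot_edge_period[OF subE[OF that], of 0] by (simp add: act_def)
  have "\<exists>e\<in>E. \<exists>j. 0 < j \<and> j < N \<and> act j e = e"
  proof (rule ccontr)
    assume free: "\<not> ?thesis"
    have "{j \<in> {..<N}. act j e = e} = {0}" if "e \<in> E" for e
    proof (intro equalityI subsetI)
      fix j assume "j \<in> {j \<in> {..<N}. act j e = e}"
      then show "j \<in> {0}" using free that by auto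
    qed (use N act0[OF that] in auto)
    then have "card E = (\<Sum>e\<in>E. card {j \<in> {..<N}. act j e = e})" by simp
    also have "\<dots> = N * card ((\<lambda>e. {act j e | j. True}) ` E)"
      using simple_graph_finite_edges[OF t] N closed add period by (intro burnside_cyclic) auto
    finally have "N dvd card E" by simp
    moreover have "N dvd card E + 1" using N_eq card_E by simp
    ultimately have "N dvd 1" by (simp only: dvd_add_right_iff)
    then show False using N by simp
  qed
  then obtain e j where e: "e \<in> E" "0 < j" "j < N" "act j e = e" by blast
  let ?r = "rot_vertex n (j * k)"
  have njk: "\<not> n dvd j * k" using dvd[of j] nat_dvd_not_less[OF e(2,3)] by blast
  obtain a b where ab: "e = {a, b}" "a \<in> {1..n}" "b \<in> {1..n}" using simple_graph_edgeE[OF t e(1)] by metis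
  have "{?r a, ?r b} = {a, b}" using e(4) ab(1) by (simp add: act_def)
  moreover have "?r a \<noteq> a" using rot_vertex_eq_self_iff[OF ab(2)] njk by simp
  ultimately have r: "?r a = b" "?r b = a" by (auto simp: doubleton_eq_iff)
  \<comment> \<open>The ends of the fixed edge are exchanged, so applying the rotation twice fixes
    \<open>a\<close>.\<close>
  then have "rot_vertex n (j * k + j * k) a = a" using ab(2) rot_vertex_add by simp
  then have dvd2: "n dvd 2 * (j * k)" using rot_vertex_eq_self_iff[OF ab(2)] by (simp add: mult_2)
  have "even n"
  proof (rule ccontr)
    assume "odd n"
    then have "coprime n 2" by simp
    then show False using njk dvd2 by (simp only: coprime_dvd_mult_right_iff)
  qed
  then obtain m where m: "n = 2 * m" by blast
  have "m dvd j * k" using dvd2 m by simp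
  then obtain t where t: "j * k = m * t" by blast
  \<comment> \<open>An even \<open>t\<close> would make \<open>n\<close> divide
    \<open>j * k\<close>. So \<open>j * k\<close> is congruent to \<open>m\<close>, and
    \<open>b\<close> is the antipode of \<open>a\<close>.\<close>
  have "odd t" using njk m t by auto
  then obtain q where "t = 2 * q + 1" by (rule oddE)
  then have jk: "j * k = m + n * q" using t m by simp
  have b: "b = rot_vertex n m a"
  proof -
    have "rot_vertex n (j * k) a = rot_vertex n m (rot_vertex n (n * q) a)"
      unfolding jk using ab(2) by (intro rot_vertex_add) simp
    then show ?thesis using r(1) rot_vertex_eq_self_iff[OF ab(2), of "n * q"] by simp
  qed
  \<comment> \<open>So far only a power of the rotation is known to be the half-turn. The rotation
    itself sends the diameter to a diameter of \<open>E\<close>, hence to the same one.\<close>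
  define a' where "a' = rot_vertex n k a"
  have a': "a' \<in> {1..n}" unfolding a'_def using k by (intro rot_vertex_in) simp
  have "{a', rot_vertex n k b} \<in> E"
    using rot_edge_in_rot_tree[of a b E n k] e(1) ab(1) unfolding inv a'_def by simp
  also have "rot_vertex n k b = rot_vertex n m a'"
    unfolding a'_def b using rot_vertex_add[of a n k m] rot_vertex_add[of a n m k] ab(2)
    by (simp add: add.commute)
  finally have e': "{a', rot_vertex n m a'} \<in> E" .
  obtain i where i: "i < m" "{a, rot_vertex n m a} = {1 + i, 1 + i + m}"
    using diameter_form[of a m] ab(2) m by auto
  obtain i' where i': "i' < m" "{a', rot_vertex n m a'} = {1 + i', 1 + i' + m}"
    using diameter_form[of a' m] a' m by auto
  have diam: "{1 + i, 1 + i + m} \<in> E" using e(1) ab(1) b i(2) by simp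
  moreover have "{1 + i', 1 + i' + m} \<in> E" using e' i'(2) by simp
  ultimately have "i = i'" using diameter_unique[OF cf] i(1) i'(1) by blast
  then have "a' \<in> {a, rot_vertex n m a}" using i i' by blast
  moreover have "a' \<noteq> a"
    unfolding a'_def using rot_vertex_eq_self_iff[OF ab(2)] k by (auto dest: dvd_imp_le)
  ultimately have am: "rot_vertex n k a = rot_vertex n m a" by (simp add: a'_def)
  have "rot_vertex n (m + k) a = rot_vertex n m (rot_vertex n m a)"
    using rot_vertex_add[of a n m k] ab(2) am by simp
  also have "\<dots> = rot_vertex n (m + m) a" using rot_vertex_add[of a n m m] ab(2) by simp
  also have "\<dots> = a" using rot_vertex_eq_self_iff[OF ab(2)] m by (simp add: mult_2)
  finally have "n dvd m + k" using rot_vertex_eq_self_iff[OF ab(2)] by simp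
  \<comment> \<open>As 0 < k < n and n = 2 * m, the sum \<open>m + k\<close> lies strictly between 0
    and 2 * n.\<close>
  then obtain c where c: "m + k = n * c" by blast
  have "c = 1"
  proof (rule ccontr)
    assume "c \<noteq> 1"
    then have "c = 0 \<or> 2 \<le> c" by auto
    then have "m + k = 0 \<or> n * 2 \<le> m + k" unfolding c by auto
    then show False using k m by auto
  qed
  then have "k = m" using c m by simp
  then show "n = 2 * k" "\<exists>i<k. {1 + i, 1 + i + k} \<in> E" using m diam i(1) by auto
qed

text \<open>The half-turn exchanges the labels \<open>{1..Suc m}\<close> on one side of the diameter
  with those on the other side, ends included. Hence both sides carry equally many edges and only
  the diameter is shared.\<close>

lemma half_of_symmetric_tree:
  assumes E: "E \<in> nc_trees {1..2 * m}" and m: "1 \<le> m" and inv: "rot_tree (2 * m) m E = E"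
    and diam: "{1, Suc m} \<in> E"
  shows "E \<inter> Pow {1..Suc m} \<in> nc_trees {1..Suc m}"
    and "E \<inter> Pow {1..Suc m} \<union> rot_tree (2 * m) m (E \<inter> Pow {1..Suc m}) = E"
proof -
  let ?L = "{1..Suc m}" and ?U = "insert 1 {Suc m..2 * m}"
  let ?rot = "rot_vertex (2 * m) m"
  have t: "simple_graph {1..2 * m} E" "connected_graph {1..2 * m} E" and card_E: "2 * m = Suc (card E)"
    and cf: "crossing_free E" using E by (auto simp: nc_trees_def edge_tree_def)
  define F where "F = E \<inter> Pow ?L"
  define G where "G = E \<inter> Pow ?U"
  have cases: "{a, b} \<in> F \<or> {a, b} \<in> G" if ab: "{a, b} \<in> E" for a b
  proof -
    have "a \<in> {1..2 * m}" "b \<in> {1..2 * m}" using simple_graph_edge[OF t(1) ab] by auto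
    moreover have ba: "{b, a} \<in> E" using ab by (simp add: insert_commute)
    have "\<not> (1 < a \<and> a < Suc m \<and> Suc m < b)" "\<not> (1 < b \<and> b < Suc m \<and> Suc m < a)"
      using cf diam ab ba unfolding crossing_free_def by blast+
    ultimately have "a \<in> ?L \<and> b \<in> ?L \<or> a \<in> ?U \<and> b \<in> ?U" by auto
    then show ?thesis using ab by (auto simp: F_def G_def)
  qed
  have E_eq: "E = F \<union> G"
  proof (intro equalityI subsetI)
    fix e assume "e \<in> E"
    moreover from this obtain a b where "e = {a, b}" using simple_graph_edgeE[OF t(1)] by metis
    ultimately show "e \<in> F \<union> G" using cases[of a b] by auto
  qed (auto simp: F_def G_def)
  have rotL: "?rot v \<in> ?U" if "v \<in> ?L" for v
    using that m rot_vertex_half[of v m] by auto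
  have rotU: "?rot v \<in> ?L" if "v \<in> ?U" for v
    using that m rot_vertex_half[of v m] by auto
  have rotE: "?rot ` e \<in> E" if "e \<in> E" for e
  proof -
    have "?rot ` e \<in> rot_tree (2 * m) m E" using that by (auto simp: rot_tree_def)
    then show ?thesis unfolding inv .
  qed
  have sub: "F \<subseteq> Pow {1..2 * m}" "G \<subseteq> Pow {1..2 * m}"
    using t(1) by (auto simp: F_def G_def simple_graph_def)
  have FG: "rot_tree (2 * m) m F \<subseteq> G" "rot_tree (2 * m) m G \<subseteq> F"
  proof -
    have "?rot ` e \<subseteq> ?U" if "e \<subseteq> ?L" for e using rotL that by blast
    then show "rot_tree (2 * m) m F \<subseteq> G" using rotE unfolding rot_tree_def F_def G_def by blast
    have "?rot ` e \<subseteq> ?L" if "e \<subseteq> ?U" for e using rotU that by blast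
    then show "rot_tree (2 * m) m G \<subseteq> F" using rotE unfolding rot_tree_def F_def G_def by blast
  qed
  \<comment> \<open>The half-turn is an involution, so the two inclusions in \<open>FG\<close>
    become equalities.\<close>
  have "rot_tree (2 * m) m (rot_tree (2 * m) m G) = G"
    using rot_tree_add[OF sub(2), of m m] rot_tree_period[OF sub(2), of "m + m"] by (simp add: mult_2)
  moreover have "rot_tree (2 * m) m (rot_tree (2 * m) m G) \<subseteq> rot_tree (2 * m) m F"
    using FG(2) by (auto simp: rot_tree_def)
  ultimately have G_eq: "G = rot_tree (2 * m) m F" using FG(1) by blast
  have "inj_on (\<lambda>e. ?rot ` e) F"
    using inj_on_image_Pow[OF inj_on_rot_vertex] sub(1) by (rule inj_on_subset)
  then have card_G: "card G = card F" unfolding G_eq rot_tree_def by (rule card_image)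
  have "F \<inter> G = {{1, Suc m}}"
  proof (intro equalityI subsetI)
    fix e assume "e \<in> F \<inter> G"
    then have e: "e \<in> E" "e \<subseteq> ?L" "e \<subseteq> ?U" by (auto simp: F_def G_def)
    then obtain a b where ab: "e = {a, b}" "a \<noteq> b" using simple_graph_edgeE[OF t(1)] by metis
    then have "a \<in> {1, Suc m}" "b \<in> {1, Suc m}" using e(2,3) by auto
    then show "e \<in> {{1, Suc m}}" using ab by auto
  qed (use diam m in \<open>auto simp: F_def G_def\<close>)
  moreover have "finite F" "finite G"
    using simple_graph_finite_edges[OF t(1)] by (simp_all add: F_def G_def)
  ultimately have "card E + 1 = card F + card G"
    using card_Un_Int[of F G] unfolding E_eq[symmetric] by simp
  then have card_F: "card F = m" using card_G card_E by simp
  \<comment> \<open>Vertices beyond the diameter are sent to 1. Edges of \<open>G\<close> then end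
    up within the two ends of the diameter, which is itself an edge of \<open>F\<close>.\<close>
  have "connected_graph ?L F"
  proof (rule connected_graph_map[OF t(2), of _ "\<lambda>v. if v \<in> ?L then v else 1"])
    show "?L \<subseteq> (\<lambda>v. if v \<in> ?L then v else 1) ` {1..2 * m}" using m by (force simp: image_iff)
    let ?f = "\<lambda>v. if v \<in> ?L then v else 1"
    have diamF: "{1, Suc m} \<in> F" using diam by (simp add: F_def)
    note ends = reach_edge[OF diamF] reach_sym[OF reach_edge[OF diamF]]
    fix u v assume "{u, v} \<in> E"
    then show "(?f u, ?f v) \<in> reach F"
    proof (cases "{u, v} \<in> F")
      case True
      then have "?f u = u" "?f v = v" by (auto simp: F_def)
      then show ?thesis using reach_edge[OF True] by simp
    next
      case False
      then have "{u, v} \<in> G" using cases[OF \<open>{u, v} \<in> E\<close>] by simp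
      then have "?f u \<in> {1, Suc m}" "?f v \<in> {1, Suc m}" by (auto simp: G_def)
      then show ?thesis using ends by (elim insertE emptyE) (simp_all only: rtrancl.rtrancl_refl)
    qed
  qed auto
  moreover have "simple_graph ?L F" using t(1) by (auto simp: F_def simple_graph_def)
  moreover have "crossing_free F" by (rule crossing_free_mono[OF cf]) (simp add: F_def)
  ultimately have "F \<in> nc_trees ?L" using card_F by (simp add: nc_trees_def edge_tree_def)
  moreover have "E \<inter> Pow ?L = F" by (simp add: F_def)
  ultimately show "E \<inter> Pow ?L \<in> nc_trees ?L" "E \<inter> Pow ?L \<union> rot_tree (2 * m) m (E \<inter> Pow ?L) = E"
    using E_eq G_eq by simp_all
qed

text \<open>The tree and its half-turn share exactly the diameter, whose ends the half-turn
  exchanges, so the union has 2 * m - 1 edges; edges on opposite sides of the diameter cannot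
  cross.\<close>

lemma symmetric_tree_of_half:
  assumes F: "F \<in> nc_trees {1..Suc m}" and m: "1 \<le> m" and diam: "{1, Suc m} \<in> F"
  defines "E \<equiv> F \<union> rot_tree (2 * m) m F"
  shows "E \<in> nc_trees {1..2 * m}" "rot_tree (2 * m) m E = E" "{1, Suc m} \<in> E"
    and "E \<inter> Pow {1..Suc m} = F"
proof -
  let ?L = "{1..Suc m}" and ?U = "insert 1 {Suc m..2 * m}"
  let ?rot = "rot_vertex (2 * m) m"
  let ?G = "rot_tree (2 * m) m F"
  have t: "simple_graph ?L F" "connected_graph ?L F" and card_F: "card F = m"
    and cf: "crossing_free F" using F by (auto simp: nc_trees_def edge_tree_def)
  have L: "?L \<subseteq> {1..2 * m}" using m by auto
  have t': "simple_graph {1..2 * m} F"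
    using t(1) L unfolding simple_graph_def by (meson finite_atLeastAtMost subset_trans)
  have sub: "F \<subseteq> Pow {1..2 * m}" using t' by (auto simp: simple_graph_def)
  have rotL: "?rot v \<in> ?U" if "v \<in> ?L" for v
    using that m rot_vertex_half[of v m] by auto
  have rot_image: "?rot ` ?L = ?U"
  proof (intro equalityI subsetI)
    fix v assume v: "v \<in> ?U"
    show "v \<in> ?rot ` ?L"
    proof (cases "v = 1")
      case True
      then show ?thesis using m rot_vertex_half[of "Suc m" m] by (intro image_eqI[of _ _ "Suc m"]) auto
    next
      case False
      then have "v - m \<in> {1..2 * m}" "v - m \<le> m" "m \<le> v" "v - m \<in> ?L" using v by auto
      then show ?thesis using rot_vertex_half[of "v - m" m] by (intro image_eqI[of _ _ "v - m"]) simp_all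
    qed
  next
    fix v assume "v \<in> ?rot ` ?L"
    then show "v \<in> ?U" using rotL by blast
  qed
  have tG: "edge_tree ?U ?G"
    using edge_tree_image[of ?L F ?rot] inj_on_subset[OF inj_on_rot_vertex L] F
    unfolding rot_image rot_tree_def by (simp add: nc_trees_def)
  have cfG: "crossing_free ?G" using crossing_free_rot_tree(2)[OF t' cf] .
  have rot_diam: "{1, Suc m} \<in> ?G"
    using rot_edge_in_rot_tree[OF diam, of "2 * m" m] rot_vertex_half[of 1 m]
      rot_vertex_half[of "Suc m" m] m by (simp add: insert_commute)
  have small: "e = {1, Suc m}" if "e \<in> F \<union> ?G" "e \<subseteq> ?L" "e \<subseteq> ?U" for e
  proof -
    have "card e = 2" using that(1) t(1) tG by (auto simp: simple_graph_def edge_tree_def)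
    then obtain a b where ab: "e = {a, b}" "a \<noteq> b" by (meson card_2_iff)
    then have "a \<in> {1, Suc m}" "b \<in> {1, Suc m}" using that(2,3) by auto
    then show ?thesis using ab by auto
  qed
  have FL: "F \<subseteq> Pow ?L" using t(1) by (auto simp: simple_graph_def)
  have GU: "?G \<subseteq> Pow ?U" using tG by (auto simp: simple_graph_def edge_tree_def)
  have inter: "F \<inter> ?G = {{1, Suc m}}" using small FL GU diam rot_diam by blast
  have card_G: "card ?G = m" using tG m by (simp add: edge_tree_def)
  have "finite F" "finite ?G"
    using t(1) tG by (auto simp: edge_tree_def intro: simple_graph_finite_edges)
  then have "card E + 1 = 2 * m"
    using card_Un_Int[of F ?G] inter card_F card_G by (simp add: E_def)
  moreover have "?L \<union> ?U = {1..2 * m}" using m by auto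
  moreover have "connected_graph (?L \<union> ?U) E"
    unfolding E_def using tG t(2) by (intro connected_graph_Un) (auto simp: edge_tree_def)
  moreover have "simple_graph (?L \<union> ?U) E"
    unfolding E_def using tG t(1) by (auto simp: edge_tree_def simple_graph_def)
  moreover have "crossing_free E"
    unfolding E_def
  proof (rule crossing_free_Un[OF cf cfG])
    fix a b c d assume "{a, b} \<in> F" "{c, d} \<in> ?G"
    then have "{a, b} \<subseteq> ?L" "{c, d} \<subseteq> ?U" using FL GU by blast+
    then show "\<not> (a < c \<and> c < b \<and> b < d) \<and> \<not> (c < a \<and> a < d \<and> d < b)" by auto
  qed
  ultimately show "E \<in> nc_trees {1..2 * m}" by (simp add: nc_trees_def edge_tree_def)
  have "rot_tree (2 * m) m ?G = F"
    using rot_tree_add[OF sub, of m m] rot_tree_period[OF sub, of "m + m"] by (simp add: mult_2)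
  then show "rot_tree (2 * m) m E = E" by (auto simp: E_def rot_tree_def image_Un)
  show "{1, Suc m} \<in> E" using diam by (simp add: E_def)
  have "e \<in> F" if "e \<in> ?G" "e \<subseteq> ?L" for e
    using small[of e] that GU diam by blast
  then show "E \<inter> Pow ?L = F" using FL by (auto simp: E_def)
qed

lemma card_symmetric_trees:
  assumes m: "1 \<le> m"
  shows "card {E \<in> nc_trees {1..2 * m}. rot_tree (2 * m) m E = E} = m * num_nct_root1 (Suc m)"
proof -
  let ?n = "2 * m"
  let ?S = "{E \<in> nc_trees {1..?n}. rot_tree ?n m E = E}"
  \<comment> \<open>Symmetric trees are sorted by their diameter, which exists by
    \<open>rot_fixed_tree\<close> and is unique by \<open>diameter_unique\<close>.\<close>
  define S where "S i = {E \<in> ?S. {1 + i, 1 + i + m} \<in> E}" for i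
  have fin: "finite (S i)" for i
    unfolding S_def by (rule finite_subset[OF _ finite_nc_trees[of "{1..?n}"]]) auto
  have "?S = (\<Union>i<m. S i)"
    using rot_fixed_tree(2)[of _ ?n m] m unfolding S_def by fastforce
  moreover have "S i \<inter> S j = {}" if "i < m" "j < m" "i \<noteq> j" for i j
    using diameter_unique[of _ i m j] that by (auto simp: S_def nc_trees_def)
  ultimately have card_sum: "card ?S = (\<Sum>i<m. card (S i))"
    using fin by (simp add: card_UN_disjoint)
  have eq: "card (S i) = card (S 0)" if i: "i < m" for i
  proof -
    have sub: "E \<subseteq> Pow {1..?n}" if "E \<in> nc_trees {1..?n}" for E
      using that nc_trees_subset by blast
    \<comment> \<open>Rotations commute with the half-turn and so preserve the symmetry.\<close>
    have move: "rot_tree ?n l E \<in> ?S" if "E \<in> ?S" for l E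
    proof -
      have E: "E \<in> nc_trees {1..?n}" "rot_tree ?n m E = E" using that by auto
      then have "rot_tree ?n m (rot_tree ?n l E) = rot_tree ?n l (rot_tree ?n m E)"
        using rot_tree_add[OF sub[OF E(1)], of m l] rot_tree_add[OF sub[OF E(1)], of l m]
        by (simp add: add.commute)
      then show ?thesis using E rot_tree_nc_trees by simp
    qed
    have rot: "rot_vertex ?n i 1 = 1 + i" "rot_vertex ?n i (1 + m) = 1 + i + m"
      "rot_vertex ?n (?n - i) (1 + i) = 1" "rot_vertex ?n (?n - i) (1 + i + m) = 1 + m"
      using i by (simp_all add: rot_vertex_def)
    have undo: "rot_tree ?n (?n - i) (rot_tree ?n i E) = E" "rot_tree ?n i (rot_tree ?n (?n - i) E) = E"
      if "E \<in> ?S" for E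
      using rot_tree_add[of E ?n "?n - i" i] rot_tree_add[of E ?n i "?n - i"]
        rot_tree_period[of E ?n ?n] sub[of E] that i by auto
    have "bij_betw (rot_tree ?n i) (S 0) (S i)"
    proof (rule bij_betw_byWitness[where f' = "rot_tree ?n (?n - i)"])
      show "rot_tree ?n i ` S 0 \<subseteq> S i"
        using move rot_edge_in_rot_tree[of 1 "1 + m" _ ?n i] unfolding rot S_def by auto
      show "rot_tree ?n (?n - i) ` S i \<subseteq> S 0"
        using move rot_edge_in_rot_tree[of "1 + i" "1 + i + m" _ ?n "?n - i"] unfolding rot S_def by auto
    qed (use undo in \<open>auto simp: S_def\<close>)
    then show ?thesis by (simp add: bij_betw_same_card)
  qed
  have "(\<Sum>i<m. card (S i)) = (\<Sum>i<m. card (S 0))"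
    by (rule sum.cong[OF refl], rule eq) simp
  with card_sum have card_S: "card ?S = m * card (S 0)" by simp
  have "bij_betw (\<lambda>E. E \<inter> Pow {1..Suc m}) (S 0) {F \<in> nc_trees {1..Suc m}. {1, Suc m} \<in> F}"
  proof (rule bij_betw_byWitness[where f' = "\<lambda>F. F \<union> rot_tree ?n m F"])
    show "\<forall>E\<in>S 0. E \<inter> Pow {1..Suc m} \<union> rot_tree ?n m (E \<inter> Pow {1..Suc m}) = E"
      using half_of_symmetric_tree(2)[OF _ m] by (auto simp: S_def)
    show "\<forall>F\<in>{F \<in> nc_trees {1..Suc m}. {1, Suc m} \<in> F}.
        (F \<union> rot_tree ?n m F) \<inter> Pow {1..Suc m} = F"
      using symmetric_tree_of_half(4)[OF _ m] by auto
    show "(\<lambda>E. E \<inter> Pow {1..Suc m}) ` S 0 \<subseteq> {F \<in> nc_trees {1..Suc m}. {1, Suc m} \<in> F}"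
      using half_of_symmetric_tree(1)[OF _ m] by (auto simp: S_def)
    show "(\<lambda>F. F \<union> rot_tree ?n m F) ` {F \<in> nc_trees {1..Suc m}. {1, Suc m} \<in> F} \<subseteq> S 0"
      using symmetric_tree_of_half(1-3)[OF _ m] by (auto simp: S_def)
  qed
  then have "card (S 0) = card {F \<in> nc_trees {1..Suc m}. {1, Suc m} \<in> F}"
    by (rule bij_betw_same_card)
  also have "\<dots> = num_nct_root1 (Suc m)"
    using card_nc_trees_last_edge[of "Suc m"] num_nct_root1_eq[of "Suc m"] m by simp
  finally show ?thesis unfolding card_S by simp
qed

section \<open>Counting orbits through stabilizers of size one or two\<close>

theorem theorem3p8:
  fixes n :: nat
  assumes "n \<ge> 1"
  shows "real (num_nct_rot n) =
    1 / real n * (real (num_nct n) +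
      (if even n then real n / 2 * real (num_nct_root1 (n div 2 + 1)) else 0))"
proof -
  let ?T = "nc_trees {1..n}"
  have fin: "finite ?T" by (simp add: finite_nc_trees)
  have sub: "E \<subseteq> Pow {1..n}" if "E \<in> ?T" for E using that nc_trees_subset by blast
  have "n * num_nct_rot n = n * card ((\<lambda>E. {rot_tree n k E | k. True}) ` ?T)"
    by (simp add: num_nct_rot_def noncrossing_trees_eq rot_orbit_def[abs_def])
  also have "\<dots> = (\<Sum>E\<in>?T. card {k \<in> {..<n}. rot_tree n k E = E})"
    using assms fin
    by (intro burnside_cyclic[symmetric] rot_tree_nc_trees rot_tree_add rot_tree_period sub) auto
  \<comment> \<open>The index 0 always stabilizes \<open>E\<close>; the only other candidate is the
    half-turn.\<close>
  also have "\<dots> = (\<Sum>E\<in>?T. 1 + (if even n \<and> rot_tree n (n div 2) E = E then 1 else 0))"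
  proof (rule sum.cong)
    fix E assume E: "E \<in> ?T"
    have "{k \<in> {..<n}. rot_tree n k E = E} =
      insert 0 (if even n \<and> rot_tree n (n div 2) E = E then {n div 2} else {})" (is "?A = ?B")
    proof (intro equalityI subsetI)
      fix k assume k: "k \<in> ?A"
      show "k \<in> ?B"
      proof (cases "k = 0")
        case False
        then have "n = 2 * k" using rot_fixed_tree(1)[OF E, of k] k by simp
        then show ?thesis using k by simp
      qed simp
    next
      fix k assume "k \<in> ?B"
      then have "k = 0 \<or> k = n div 2 \<and> rot_tree n (n div 2) E = E" by (auto split: if_splits)
      then show "k \<in> ?A" using assms rot_tree_period[OF sub[OF E], of 0] by auto
    qed
    \<comment> \<open>The half-turn must differ from index 0 in order to count as a second
      element.\<close>
    moreover have "n div 2 \<noteq> 0" if "even n" using that assms by auto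
    ultimately show "card {k \<in> {..<n}. rot_tree n k E = E} =
      1 + (if even n \<and> rot_tree n (n div 2) E = E then 1 else 0)" by simp
  qed simp
  also have "\<dots> = card ?T + card {E \<in> ?T. even n \<and> rot_tree n (n div 2) E = E}"
    using fin by (simp only: sum.distrib card_eq_sum sum.inter_filter)
  also have "card ?T = num_nct n" by (simp add: num_nct_def noncrossing_trees_eq)
  finally have main: "n * num_nct_rot n = num_nct n + card {E \<in> ?T. even n \<and> rot_tree n (n div 2) E = E}" .
  have count: "card {E \<in> ?T. even n \<and> rot_tree n (n div 2) E = E} =
      (if even n then n div 2 * num_nct_root1 (n div 2 + 1) else 0)"
  proof (cases "even n")
    case True
    then obtain m where m: "n = 2 * m" by blast
    then show ?thesis using card_symmetric_trees[of m] assms by simp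
  qed simp
  have "real n * real (num_nct_rot n) = real (num_nct n) +
      (if even n then real (n div 2) * real (num_nct_root1 (n div 2 + 1)) else 0)"
    unfolding of_nat_mult[symmetric] main count by simp
  then show ?thesis using assms by (auto simp: field_simps real_of_nat_div)
qed

end
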